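(* Let $0<\ell<L$ and let $\mu$ be an expected spectral distribution that has a density which is strictly positive on the interval $[\ell,L]$ and zero outside $[\ell,L]$. Let $a_t,b_t$ be the parameters of the optimal average-case method for $\mu$, i.e. the coefficients of the three-term recurrence $$P_t(\lambda)=(a_t+b_t\lambda)P_{t-1}(\lambda)+(1-a_t)P_{t-2}(\lambda)\quad(t\ge 2),\qquad P_0(\lambda)=1,\quad P_1(\lambda)=1+b_1\lambda,$$ satisfied by the sequence $(P_t)_{t\ge 0}$ of residual polynomials orthogonal with respect to $\lambda\,d\mu(\lambda)$. Then these parameters converge to those of Polyak momentum: $$\lim_{t\to\infty}(a_t-1)=\left(\frac{\sqrt{L}-\sqrt{\ell}}{\sqrt{L}+\sqrt{\ell}}\right)^2\qquad\text{and}\qquad \lim_{t\to\infty} b_t=-\left(\frac{2}{\sqrt{L}+\sqrt{\ell}}\right)^2 .$$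
   Context: **Problem class.** Let $H\in\mathbb{R}^{d\times d}$ be a random symmetric positive-definite matrix and $x^\star\in\mathbb{R}^d$ a random vector. The problem is to minimize $f(x)=\frac12 (x-x^\star)^\top H(x-x^\star)$ over $x\in\mathbb{R}^d$. **Expected spectral distribution.** If $H$ has eigenvalues $\lambda_1,\dots,\lambda_d$, its empirical spectral measure is $\mu_H=\frac1d\sum_{i=1}^d\delta_{\lambda_i}$. The expected spectral distribution is the probability measure $\mu=\mathbb{E}_H[\mu_H]$ on $\mathbb{R}$. **Residual orthogonal polynomials.** A sequence of real polynomials $P_0,P_1,\dots$ is orthogonal with respect to a measure $d\alpha$ if $\deg P_i=i$, $\int P_iP_j\,d\alpha=0$ for $i\ne j$, and $\int P_i^2\,d\alpha>0$. The sequence is called residual orthogonal if in addition $P_i(0)=1$ for all $i$. Residual orthogonal polynomials satisfy a three-term recurrence of the form written in the claim, with real coefficients $a_t,b_t$. **Optimal average-case method.** With $a_t,b_t$ the recurrence coefficients for the residual polynomials orthogonal with respect to $\lambda\,d\mu(\lambda)$, the method is $x_1=x_0+b_1\nabla f(x_0)$ and $x_t=x_{t-1}+(a_t-1)(x_{t-1}-x_{t-2})+b_t\nabla f(x_{t-1})$ for $t\ge2$. **Polyak momentum.** The method is $x_1=x_0-\frac{2}{L+\ell}\nabla f(x_0)$ and $x_{t+1}=x_t+\left(\frac{\sqrt L-\sqrt\ell}{\sqrt L+\sqrt\ell}\right)^2(x_t-x_{t-1})-\left(\frac{2}{\sqrt L+\sqrt\ell}\right)^2\nabla f(x_t)$ for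 $t\ge1$. *)

theory Defs
  imports "HOL-Probability.Probability" "HOL-Computational_Algebra.Polynomial"
begin

definition symmetric_positive_definite :: "real^'n^'n \<Rightarrow> bool" where
  "symmetric_positive_definite A \<longleftrightarrow> transpose A = A \<and> (\<forall>v. v \<noteq> 0 \<longrightarrow> v \<bullet> (A *v v) > 0)"

definition charpoly :: "'a::comm_ring_1^'n^'n \<Rightarrow> 'a poly" where
  "charpoly A = det (\<chi> i j. (if i = j then [:0, 1:] else 0) - [:A $ i $ j:])"

text \<open>Only the eigenvalues in the base field are collected, with algebraic multiplicity. A real
  symmetric matrix of size \<open>d\<close> has exactly \<open>d\<close> of them.\<close>

definition eigenvalues :: "real^'n^'n \<Rightarrow> real multiset" where
  "eigenvalues A = proots (charpoly A)"

definition empirical_spectral_measure :: "real^'n^'n \<Rightarrow> real measure" where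
  "empirical_spectral_measure A =
     measure_of UNIV (sets borel)
       (\<lambda>S. (\<Sum>x\<in>#eigenvalues A. emeasure (return borel x) S) / of_nat CARD('n))"

definition expected_spectral_distribution ::
    "'w measure \<Rightarrow> ('w \<Rightarrow> real^'n^'n) \<Rightarrow> real measure" where
  "expected_spectral_distribution M H =
     measure_of UNIV (sets borel)
       (\<lambda>S. \<integral>\<^sup>+\<omega>. emeasure (empirical_spectral_measure (H \<omega>)) S \<partial>M)"

lemma sets_empirical_spectral_measure: "sets (empirical_spectral_measure A) = sets borel"
  using sets.sigma_sets_eq[of "borel :: real measure"]
  by (simp add: empirical_spectral_measure_def)

lemma sets_expected_spectral_distribution: "sets (expected_spectral_distribution M H) = sets borel"
  using sets.sigma_sets_eq[of "borel :: real measure"]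
  by (simp add: expected_spectral_distribution_def)

text \<open>\<open>measure_of\<close> yields the null measure when given a set function that is not countably
  additive. The next two lemmas show that the set functions above are countably additive; for the
  second one this uses that the eigenvalue count in a Borel set is a Borel function of the
  matrix, a standard fact taken as a premise here.\<close>

lemma emeasure_empirical_spectral_measure:
  fixes A :: "real^'n^'n"
  assumes "S \<in> sets borel"
  shows "emeasure (empirical_spectral_measure A) S =
           (\<Sum>x\<in>#eigenvalues A. emeasure (return borel x) S) / of_nat CARD('n)"
proof (rule emeasure_measure_of[OF empirical_spectral_measure_def])
  have sums: "(\<Sum>i. \<Sum>x\<in>#E. emeasure (return borel x) (F i)) =
      (\<Sum>x\<in>#E. emeasure (return borel x) (\<Union>i. F i))"
    if F: "range F \<subseteq> sets borel" "disjoint_family F" for F :: "nat \<Rightarrow> real set" and E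
  proof (induction E)
    case (add y E)
    have "(\<Sum>i. emeasure (return borel y) (F i)) = emeasure (return borel y) (\<Union>i. F i)"
      using F by (intro suminf_emeasure) auto
    then show ?case
      using add by (simp add: suminf_add[symmetric] del: emeasure_return)
  qed simp
  show "countably_additive (sets (empirical_spectral_measure A))
      (\<lambda>S. (\<Sum>x\<in>#eigenvalues A. emeasure (return borel x) S) / of_nat CARD('n))"
  proof (rule countably_additiveI)
    fix F :: "nat \<Rightarrow> real set"
    assume "range F \<subseteq> sets (empirical_spectral_measure A)" "disjoint_family F"
    then have F: "range F \<subseteq> sets borel" "disjoint_family F"
      by (simp_all add: sets_empirical_spectral_measure)
    show "(\<Sum>i. (\<Sum>x\<in>#eigenvalues A. emeasure (return borel x) (F i)) / of_nat CARD('n)) =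
        (\<Sum>x\<in>#eigenvalues A. emeasure (return borel x) (\<Union>i. F i)) / of_nat CARD('n)"
      unfolding divide_ennreal_def ennreal_suminf_multc sums[OF F] ..
  qed
  have "(\<Sum>x\<in>#E. emeasure (return borel x) {}) = 0" for E :: "real multiset"
    by (induction E) (simp_all del: emeasure_return)
  then show "positive (sets (empirical_spectral_measure A))
      (\<lambda>S. (\<Sum>x\<in>#eigenvalues A. emeasure (return borel x) S) / of_nat CARD('n))"
    by (simp add: positive_def del: emeasure_return)
qed (use assms in \<open>simp_all add: sets_empirical_spectral_measure\<close>)

lemma emeasure_expected_spectral_distribution:
  fixes H :: "'w \<Rightarrow> real^'n^'n"
  assumes "\<And>T. T \<in> sets borel \<Longrightarrow>
      (\<lambda>\<omega>. emeasure (empirical_spectral_measure (H \<omega>)) T) \<in> borel_measurable M"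
    and "S \<in> sets borel"
  shows "emeasure (expected_spectral_distribution M H) S =
           (\<integral>\<^sup>+\<omega>. emeasure (empirical_spectral_measure (H \<omega>)) S \<partial>M)"
proof (rule emeasure_measure_of[OF expected_spectral_distribution_def])
  show "countably_additive (sets (expected_spectral_distribution M H))
      (\<lambda>S. \<integral>\<^sup>+\<omega>. emeasure (empirical_spectral_measure (H \<omega>)) S \<partial>M)"
  proof (rule countably_additiveI)
    fix F :: "nat \<Rightarrow> real set"
    assume "range F \<subseteq> sets (expected_spectral_distribution M H)" and disj: "disjoint_family F"
    then have F: "range F \<subseteq> sets borel"
      by (simp add: sets_expected_spectral_distribution)
    have "(\<Sum>i. \<integral>\<^sup>+\<omega>. emeasure (empirical_spectral_measure (H \<omega>)) (F i) \<partial>M) =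
        (\<integral>\<^sup>+\<omega>. (\<Sum>i. emeasure (empirical_spectral_measure (H \<omega>)) (F i)) \<partial>M)"
      using F by (intro nn_integral_suminf[symmetric] assms(1)) auto
    also have "\<dots> = (\<integral>\<^sup>+\<omega>. emeasure (empirical_spectral_measure (H \<omega>)) (\<Union>i. F i) \<partial>M)"
      using F disj
      by (intro nn_integral_cong suminf_emeasure) (simp_all add: sets_empirical_spectral_measure)
    finally show "(\<Sum>i. \<integral>\<^sup>+\<omega>. emeasure (empirical_spectral_measure (H \<omega>)) (F i) \<partial>M) =
        (\<integral>\<^sup>+\<omega>. emeasure (empirical_spectral_measure (H \<omega>)) (\<Union>i. F i) \<partial>M)" .
  qed
  show "positive (sets (expected_spectral_distribution M H))
      (\<lambda>S. \<integral>\<^sup>+\<omega>. emeasure (empirical_spectral_measure (H \<omega>)) S \<partial>M)"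
    by (simp add: positive_def)
qed (use assms(2) in \<open>simp_all add: sets_expected_spectral_distribution\<close>)

text \<open>The integrals are Bochner integrals, which vanish for non-integrable functions. Positivity
  of the square integrals therefore makes all the products integrable.\<close>

definition orthogonal_polynomials :: "real measure \<Rightarrow> (nat \<Rightarrow> real poly) \<Rightarrow> bool" where
  "orthogonal_polynomials \<alpha> P \<longleftrightarrow>
     (\<forall>i. degree (P i) = i) \<and>
     (\<forall>i j. i \<noteq> j \<longrightarrow> (\<integral>x. poly (P i) x * poly (P j) x \<partial>\<alpha>) = 0) \<and>
     (\<forall>i. (\<integral>x. (poly (P i) x)\<^sup>2 \<partial>\<alpha>) > 0)"

definition residual_orthogonal_polynomials :: "real measure \<Rightarrow> (nat \<Rightarrow> real poly) \<Rightarrow> bool" where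
  "residual_orthogonal_polynomials \<alpha> P \<longleftrightarrow>
     orthogonal_polynomials \<alpha> P \<and> (\<forall>i. poly (P i) 0 = 1)"

definition three_term_recurrence ::
    "(nat \<Rightarrow> real poly) \<Rightarrow> (nat \<Rightarrow> real) \<Rightarrow> (nat \<Rightarrow> real) \<Rightarrow> bool" where
  "three_term_recurrence P a b \<longleftrightarrow>
     (\<forall>x. poly (P 0) x = 1) \<and>
     (\<forall>x. poly (P 1) x = 1 + b 1 * x) \<and>
     (\<forall>t\<ge>2. \<forall>x. poly (P t) x =
        (a t + b t * x) * poly (P (t - 1)) x + (1 - a t) * poly (P (t - 2)) x)"

text \<open>The coefficients \<open>a t\<close> (\<open>t \<ge> 2\<close>) and \<open>b t\<close> (\<open>t \<ge> 1\<close>) of the optimal average-case method.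
  The weight \<open>ennreal x\<close> truncates negative \<open>x\<close> to \<open>0\<close>, so it is \<open>x\<close> only where \<open>\<mu>\<close> lives on the
  nonnegative reals, as spectral distributions of positive definite matrices do.\<close>

definition optimal_average_case_parameters ::
    "real measure \<Rightarrow> (nat \<Rightarrow> real) \<Rightarrow> (nat \<Rightarrow> real) \<Rightarrow> bool" where
  "optimal_average_case_parameters \<mu> a b \<longleftrightarrow>
     (\<exists>P. residual_orthogonal_polynomials (density \<mu> (\<lambda>x. ennreal x)) P \<and>
          three_term_recurrence P a b)"

end

theory Submission
  imports Defs "HOL-Complex_Analysis.Cauchy_Integral_Formula"
begin

text \<open>The residual polynomials are orthogonal with respect to the weight \<open>w x = x * f x\<close>, which is
positive on \<open>[l, L]\<close>. For such a weight Rakhmanov's theorem says that the recurrence coefficients of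
the orthogonal polynomials forget everything about the weight except the interval, so that they have
the same limits as for any explicit weight on \<open>[l, L]\<close>; those limits are the Polyak parameters.

Rakhmanov's theorem is proved on the unit circle. The substitution \<open>x = c + r cos t\<close>, with centre
\<open>c\<close> and radius \<open>r\<close> of the interval, turns \<open>w\<close> into a weight \<open>W\<close> on the upper half circle. The monic
orthogonal polynomials \<open>\<Phi> n\<close> of \<open>W\<close> and their reversals \<open>\<Psi> n\<close> satisfy Szego's recursion, whose
coefficients \<open>\<alpha> n\<close> are the Verblunsky coefficients, and the heart of the matter is that \<open>\<alpha> n\<close> tends
to \<open>0\<close> (\<open>verblunsky_tendsto_0\<close>). The argument follows Mate, Nevai and Totik. Write \<open>\<phi> n\<close> for the
orthonormal polynomials and \<open>\<tau> n\<close> for \<open>|\<phi> n / \<phi> (n + 1)|\<close> on the circle.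

  \<^item> The weight \<open>1 / |\<phi> n|^2\<close> has the same first moments as \<open>W\<close> (\<open>bernstein_szego_moments\<close>). Hence these
    weights converge weakly to \<open>W\<close>, and the mean of \<open>(\<tau> n)^2\<close> is exactly \<open>1\<close>.

  \<^item> For continuous \<open>F \<ge> 0\<close> the inequality between arithmetic and geometric means bounds
    \<open>F^(1/2) W^(1/4)\<close> by \<open>\<tau> n / 2 + |\<phi> (n + 1)|^2 W / 4 + F^2 / (4 |\<phi> n|^2)\<close>. The last two terms have
    integrals \<open>1/4\<close> and, in the limit, a quarter of the integral of \<open>F^2 W\<close>. Taking \<open>F\<close> close to
    \<open>W^(-1/2)\<close>, which makes sense because \<open>W\<close> is positive almost everywhere, brings the integrals of
    \<open>F^(1/2) W^(1/4)\<close> and of \<open>F^2 W\<close> as close to \<open>1\<close> as desired. So the mean of \<open>\<tau> n\<close> tends to \<open>1\<close>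
    (\<open>eventually_integral_ratio\<close>).

  \<^item> The function \<open>G = \<Psi> n / \<Psi> (n + 1)\<close> is holomorphic in the disc with \<open>G 0 = 1\<close>, and on the circle
    its real part is a function of \<open>\<tau> n\<close>. The mean value property of \<open>G^2\<close> then yields
    \<open>(\<alpha> n)^2 \<le> 16 (1 - mean of \<tau> n)\<close> (\<open>verblunsky_sq_le\<close>).

To return to the interval, put \<open>x = c + r (z + 1/z) / 2\<close>. The polynomial of degree \<open>n\<close> in \<open>x\<close> that equals
\<open>(\<Phi> (2 n) z + \<Psi> (2 n) z) / z^n\<close> is orthogonal for \<open>w\<close>, so the residual polynomial \<open>P n\<close> is this
polynomial divided by its value at \<open>x = 0\<close>. The point \<open>x = 0\<close> corresponds to
\<open>z = - (sqrt L + sqrt l) / (sqrt L - sqrt l)\<close>, which lies outside the closed disc. There \<open>\<alpha> n \<longlonglongrightarrow> 0\<close>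
makes \<open>\<Psi> n / \<Phi> n\<close> tend to \<open>0\<close> and \<open>\<Phi> (n + 1) / \<Phi> n\<close> tend to \<open>z\<close>, so the values at \<open>0\<close> grow by a
factor that tends to \<open>z\<close> (\<open>orthopoly_ratio_tendsto\<close>). This controls the leading coefficients and the
square norms of the \<open>P n\<close>, and \<open>a t\<close>, \<open>b t\<close> are expressed through these two
(\<open>recurrence_coefficients_tendsto\<close>).\<close>

section \<open>The uniform measure on the upper half circle\<close>

text \<open>Polynomials with real coefficients and symmetric weights are compatible with complex conjugation, so
that means over the circle reduce to the upper half. The half circle is also where \<open>cos\<close> is injective,
which is what the change of variables to an interval needs.\<close>

definition half_circle :: "real measure" where
  "half_circle = density lborel (\<lambda>t. ennreal (indicator {0..pi} t / pi))"

lemma sets_half_circle [measurable_cong, simp]: "sets half_circle = sets borel"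
  by (simp add: half_circle_def)

lemma space_half_circle [simp]: "space half_circle = UNIV"
  by (simp add: half_circle_def)

lemma integral_half_circle:
  fixes f :: "real \<Rightarrow> real"
  assumes "f \<in> borel_measurable borel"
  shows "integral\<^sup>L half_circle f = (LINT t:{0..pi}|lborel. f t) / pi"
  unfolding half_circle_def set_lebesgue_integral_def
  by (subst integral_density) (use assms in \<open>auto\<close>)

lemma integrable_half_circle_iff:
  fixes f :: "real \<Rightarrow> real"
  assumes "f \<in> borel_measurable borel"
  shows "integrable half_circle f \<longleftrightarrow> set_integrable lborel {0..pi} f"
proof -
  have "integrable half_circle f \<longleftrightarrow> integrable lborel (\<lambda>t. (1/pi) * (indicator {0..pi} t * f t))"
    unfolding half_circle_def
    by (subst integrable_density) (use assms in \<open>auto\<close>)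
  also have "\<dots> \<longleftrightarrow> integrable lborel (\<lambda>t. indicator {0..pi} t * f t)"
    by (subst integrable_mult_left_iff) auto
  finally show ?thesis by (simp add: set_integrable_def)
qed

lemma AE_half_circle: "(AE t in half_circle. P t) \<longleftrightarrow> (AE t in lborel. t \<in> {0..pi} \<longrightarrow> P t)"
proof -
  have "(AE t in half_circle. P t) \<longleftrightarrow> (AE t in lborel. 0 < ennreal (indicator {0..pi} t / pi) \<longrightarrow> P t)"
    unfolding half_circle_def by (subst AE_density) auto
  also have "(\<lambda>t. 0 < ennreal (indicator {0..pi} t / pi)) = (\<lambda>t. t \<in> {0..pi})"
    by (auto simp: fun_eq_iff indicator_def)
  finally show ?thesis by simp
qed

lemma prob_space_half_circle: "prob_space half_circle"
proof
  have "(\<integral>\<^sup>+ t. ennreal (indicator {0..pi} t / pi) \<partial>lborel) = (\<integral>\<^sup>+ t. ennreal (1/pi) * indicator {0..pi} t \<partial>lborel)"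
    by (intro nn_integral_cong) (auto simp: indicator_def)
  also have "\<dots> = ennreal (1/pi) * ennreal pi"
    by (simp add: nn_integral_cmult)
  also have "\<dots> = 1" by (simp flip: ennreal_mult)
  finally show "emeasure half_circle (space half_circle) = 1"
    unfolding half_circle_def by (simp add: emeasure_density)
qed

interpretation half_circle: prob_space half_circle
  by (rule prob_space_half_circle)

lemma prob_half_circle_UNIV [simp]: "measure half_circle UNIV = 1"
  using half_circle.prob_space by simp

lemma continuous_on_cis_comp:
  fixes h :: "complex \<Rightarrow> 'a::topological_space"
  assumes "continuous_on (sphere 0 1) h"
  shows "continuous_on UNIV (\<lambda>t. h (cis t))"
proof -
  have "continuous_on UNIV (h \<circ> cis)"
    by (rule continuous_on_compose) (auto intro!: continuous_intros continuous_on_subset[OF assms])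
  then show ?thesis by (simp add: o_def)
qed

lemma integrable_bounded_mult:
  fixes f U :: "real \<Rightarrow> real"
  assumes [measurable]: "f \<in> borel_measurable borel" and bound: "\<And>t. \<bar>f t\<bar> \<le> C"
    and U: "integrable half_circle U"
  shows "integrable half_circle (\<lambda>t. f t * U t)"
proof (rule Bochner_Integration.integrable_bound)
  have [measurable]: "U \<in> borel_measurable borel"
    using borel_measurable_integrable[OF U] by (simp cong: measurable_cong_sets)
  show "integrable half_circle (\<lambda>t. C * U t)" using U by simp
  have "C \<ge> 0" using bound[of 0] by linarith
  then have "\<bar>f t * U t\<bar> \<le> \<bar>C * U t\<bar>" for t
    using bound[of t] by (auto simp: abs_mult intro!: mult_right_mono)
  then show "AE t in half_circle. norm (f t * U t) \<le> norm (C * U t)" by auto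
  show "(\<lambda>t. f t * U t) \<in> borel_measurable half_circle" by measurable
qed

lemma integrable_circle_mult:
  fixes h :: "complex \<Rightarrow> real" and W :: "real \<Rightarrow> real"
  assumes "continuous_on (sphere 0 1) h" "integrable half_circle W"
  shows "integrable half_circle (\<lambda>t. h (cis t) * W t)"
proof -
  have "bounded (h ` sphere 0 1)"
    using assms(1) compact_continuous_image compact_imp_bounded compact_sphere by blast
  then obtain C where "\<forall>x\<in>h ` sphere 0 1. norm x \<le> C"
    unfolding bounded_iff by blast
  then show ?thesis
    by (intro integrable_bounded_mult[OF _ _ assms(2), of _ C]
        borel_measurable_continuous_onI continuous_on_cis_comp assms(1)) auto
qed

lemma integrable_circle:
  fixes h :: "complex \<Rightarrow> real"
  assumes "continuous_on (sphere 0 1) h"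
  shows "integrable half_circle (\<lambda>t. h (cis t))"
  using integrable_circle_mult[OF assms, of "\<lambda>_. 1"] by simp

text \<open>Cauchy's integral formula at the centre gives the mean over the full circle; the conjugation symmetry of
\<open>f\<close> makes the upper and the lower half contribute the same real part.\<close>

lemma mean_value_half_circle:
  assumes cont: "continuous_on (cball 0 1) f" and hol: "f holomorphic_on ball 0 1"
    and sym: "\<And>z. norm z = 1 \<Longrightarrow> f (cnj z) = cnj (f z)"
  shows "(\<integral>t. Re (f (cis t)) \<partial>half_circle) = Re (f 0)"
proof -
  define g where "g = (\<lambda>t. Re (f (cis t)))"
  have contf: "continuous_on UNIV (\<lambda>t. f (cis t))"
    by (rule continuous_on_cis_comp) (auto intro: continuous_on_subset[OF cont])
  then have contg: "continuous_on A g" for A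
    unfolding g_def by (auto intro: continuous_intros continuous_on_subset)
  have "((\<lambda>u. f u / (u - 0)) has_contour_integral 2 * of_real pi * \<i> * f 0) (circlepath 0 1)"
    by (rule Cauchy_integral_circlepath) (use cont hol in auto)
  then have "((\<lambda>t. f (cis t) / cis t * \<i> * cis t) has_integral 2 * of_real pi * \<i> * f 0) {0..2*pi}"
    unfolding circlepath_def by (subst (asm) has_contour_integral_part_circlepath_iff) auto
  then have "((\<lambda>t. - \<i> * (f (cis t) / cis t * \<i> * cis t)) has_integral - \<i> * (2 * of_real pi * \<i> * f 0)) {0..2*pi}"
    by (rule has_integral_mult_right)
  then have "((\<lambda>t. f (cis t)) has_integral 2 * of_real pi * f 0) {0..2*pi}"
    by (simp add: field_simps)
  from has_integral_Re[OF this] have full: "(g has_integral 2 * pi * Re (f 0)) {0..2*pi}"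
    by (simp add: g_def)
  \<comment> \<open>The reflection \<open>t \<mapsto> 2 pi - t\<close> exchanges the two halves.\<close>
  have "((\<lambda>x. g ((-1) *\<^sub>R x + 2*pi)) has_integral (1 / \<bar>-1\<bar> ^ DIM(real)) *\<^sub>R integral {pi..2*pi} g)
      ((\<lambda>x. (1 / (-1)) *\<^sub>R x + - ((1 / (-1)) *\<^sub>R (2*pi))) ` cbox pi (2*pi))"
    by (rule has_integral_affinity)
      (auto intro!: integrable_integral integrable_continuous_interval contg)
  also have "(\<lambda>x. (1 / (-1)) *\<^sub>R x + - ((1 / (-1)) *\<^sub>R (2*pi))) ` cbox pi (2*pi) = {0..pi}"
    by (simp add: image_affinity_atLeastAtMost[of "-1", simplified])
  also have "(\<lambda>x. g ((-1) *\<^sub>R x + 2*pi)) = g"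
  proof
    fix x
    have "cis (2 * pi - x) = cnj (cis x)"
      by (simp add: complex_eq_iff cos_diff sin_diff)
    then show "g ((-1) *\<^sub>R x + 2*pi) = g x"
      using sym[of "cis x"] by (simp add: g_def)
  qed
  finally have "integral {0..pi} g = integral {pi..2*pi} g"
    by (simp add: integral_unique)
  moreover have "integral {0..pi} g + integral {pi..2*pi} g = integral {0..2*pi} g"
    by (rule Henstock_Kurzweil_Integration.integral_combine)
      (auto intro!: integrable_continuous_interval contg)
  ultimately have "integral {0..pi} g = pi * Re (f 0)"
    using integral_unique[OF full] by simp
  moreover have "(LINT t:{0..pi}|lborel. g t) = integral {0..pi} g"
    by (intro set_borel_integral_eq_integral borel_integrable_atLeastAtMost' contg)
  moreover have "integral\<^sup>L half_circle g = (LINT t:{0..pi}|lborel. g t) / pi"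
    by (intro integral_half_circle borel_measurable_continuous_onI contg)
  ultimately show ?thesis by (simp add: g_def)
qed

section \<open>Szego polynomials of a weight on the circle\<close>

definition cpoly :: "real poly \<Rightarrow> complex \<Rightarrow> complex" where
  "cpoly p z = poly (map_poly complex_of_real p) z"

lemma cpoly_0 [simp]: "cpoly 0 z = 0"
  by (simp add: cpoly_def)

lemma cpoly_pCons [simp]: "cpoly (pCons a p) z = of_real a + z * cpoly p z"
  by (simp add: cpoly_def map_poly_pCons)

lemma cpoly_1 [simp]: "cpoly 1 z = 1"
  by (simp add: one_pCons)

lemma cpoly_add [simp]: "cpoly (p + q) z = cpoly p z + cpoly q z"
proof -
  have "map_poly complex_of_real (p + q) = map_poly of_real p + map_poly of_real q"
    by (intro poly_eqI) (simp add: coeff_map_poly)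
  then show ?thesis by (simp add: cpoly_def)
qed

lemma cpoly_smult [simp]: "cpoly (smult c p) z = of_real c * cpoly p z"
  by (simp add: cpoly_def map_poly_smult)

lemma cpoly_diff [simp]: "cpoly (p - q) z = cpoly p z - cpoly q z"
  using cpoly_add[of p "smult (-1) q" z] cpoly_smult[of "-1" q z] by simp

lemma cpoly_monom [simp]: "cpoly (monom c n) z = of_real c * z ^ n"
  by (simp add: cpoly_def map_poly_monom poly_monom)

lemma cpoly_cnj: "cpoly p (cnj z) = cnj (cpoly p z)"
  by (induction p) auto

lemma cpoly_of_real: "cpoly p (of_real x) = of_real (poly p x)"
  by (induction p) auto

lemma cpoly_altdef: "cpoly p z = (\<Sum>i\<le>degree p. of_real (coeff p i) * z ^ i)"
  by (simp add: cpoly_def poly_altdef degree_map_poly coeff_map_poly)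

lemma continuous_on_cpoly [continuous_intros]: "continuous_on A (cpoly p)"
  unfolding cpoly_def by (intro continuous_intros)

lemma holomorphic_on_cpoly [holomorphic_intros]: "cpoly p holomorphic_on A"
  unfolding cpoly_def by (intro holomorphic_intros)

lemma AE_cpoly_nonzero:
  assumes "p \<noteq> 0"
  shows "AE t in half_circle. cpoly p (cis t) \<noteq> 0"
proof -
  let ?Z = "{t\<in>{0..pi}. cpoly p (cis t) = 0}"
  have "map_poly complex_of_real p \<noteq> 0"
    using assms by (simp add: map_poly_eq_0_iff)
  then have "finite {z. cpoly p z = 0}"
    unfolding cpoly_def by (rule poly_roots_finite)
  then have "finite (cis ` ?Z)"
    by (rule rev_finite_subset) auto
  moreover have "inj_on cis ?Z"
  proof (rule inj_onI)
    fix s t assume "s \<in> ?Z" "t \<in> ?Z" "cis s = cis t"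
    then have "cos s = cos t" by (metis cis.sel(1))
    then show "s = t" using \<open>s \<in> ?Z\<close> \<open>t \<in> ?Z\<close> cos_inj_pi by auto
  qed
  ultimately have "finite ?Z" by (rule finite_imageD)
  then have "?Z \<in> null_sets lborel" by (rule finite_imp_null_set_lborel)
  then show ?thesis
    unfolding AE_half_circle by (rule AE_I') auto
qed

text \<open>For real polynomials this mean over the half circle equals the mean over the full circle of
\<open>p * cnj q\<close> for the weight extended symmetrically, so it is their inner product in the usual sense of
orthogonal polynomials on the unit circle.\<close>

definition circle_form :: "(real \<Rightarrow> real) \<Rightarrow> real poly \<Rightarrow> real poly \<Rightarrow> real" where
  "circle_form W p q = (\<integral>t. Re (cpoly p (cis t) * cnj (cpoly q (cis t))) * W t \<partial>half_circle)"

lemma integrable_circle_form: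
  assumes "integrable half_circle W"
  shows "integrable half_circle (\<lambda>t. Re (cpoly p (cis t) * cnj (cpoly q (cis t))) * W t)"
  by (rule integrable_circle_mult[OF _ assms, of "\<lambda>z. Re (cpoly p z * cnj (cpoly q z))"])
    (intro continuous_intros)

lemma circle_form_commute: "circle_form W p q = circle_form W q p"
  unfolding circle_form_def by (rule arg_cong[where f = "integral\<^sup>L half_circle"]) (auto simp: algebra_simps)

lemma circle_form_add_left:
  assumes "integrable half_circle W"
  shows "circle_form W (p + q) r = circle_form W p r + circle_form W q r"
  unfolding circle_form_def
  by (subst Bochner_Integration.integral_add[symmetric])
    (use integrable_circle_form[OF assms] in \<open>simp_all add: algebra_simps\<close>)

lemma circle_form_smult_left: "circle_form W (smult c p) r = c * circle_form W p r"
  unfolding circle_form_def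
  by (subst Bochner_Integration.integral_mult_right_zero[symmetric]) (simp add: algebra_simps)

lemma circle_form_diff_left:
  assumes "integrable half_circle W"
  shows "circle_form W (p - q) r = circle_form W p r - circle_form W q r"
  using circle_form_add_left[OF assms, of p "smult (-1) q" r] circle_form_smult_left[of W "-1" q r]
  by simp

lemma circle_form_0_left [simp]: "circle_form W 0 q = 0"
  by (simp add: circle_form_def)

text \<open>Multiplication by \<open>z\<close> is an isometry because \<open>|z| = 1\<close>; this Toeplitz property
is what makes Szego's recursion possible.\<close>

lemma circle_form_shift: "circle_form W (pCons 0 p) (pCons 0 q) = circle_form W p q"
proof -
  have "cpoly (pCons 0 p) (cis t) * cnj (cpoly (pCons 0 q) (cis t))
      = cpoly p (cis t) * cnj (cpoly q (cis t))" for t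
  proof -
    have "cpoly (pCons 0 p) (cis t) * cnj (cpoly (pCons 0 q) (cis t))
        = (cis t * cnj (cis t)) * (cpoly p (cis t) * cnj (cpoly q (cis t)))"
      by (simp add: mult_ac)
    also have "cis t * cnj (cis t) = 1"
      using complex_norm_square[of "cis t"] by simp
    finally show ?thesis by simp
  qed
  then show ?thesis by (simp only: circle_form_def)
qed

lemma circle_form_sum_right:
  assumes "integrable half_circle W"
  shows "circle_form W p q = (\<Sum>j\<le>degree q. coeff q j * circle_form W p (monom 1 j))"
proof -
  have "circle_form W (\<Sum>j\<in>A. smult (c j) (monom 1 j)) p =
      (\<Sum>j\<in>A. c j * circle_form W (monom 1 j) p)" if "finite A" for A and c :: "nat \<Rightarrow> real"
    using that by induction (simp_all add: circle_form_add_left[OF assms] circle_form_smult_left)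
  from this[of "{..degree q}" "coeff q"]
  show ?thesis
    by (simp add: circle_form_commute[of _ p] smult_monom poly_as_sum_of_monoms)
qed

lemma circle_form_sum_left:
  assumes "integrable half_circle W"
  shows "circle_form W p q = (\<Sum>j\<le>degree p. coeff p j * circle_form W (monom 1 j) q)"
  by (simp add: circle_form_commute[of W _ q] circle_form_sum_right[OF assms, of q p])

locale circle_weight =
  fixes W :: "real \<Rightarrow> real"
  assumes integrable_weight: "integrable half_circle W"
    and weight_pos: "AE t in half_circle. 0 < W t"
begin

abbreviation "B \<equiv> circle_form W"

lemmas form_left = circle_form_add_left[OF integrable_weight]
  circle_form_diff_left[OF integrable_weight] circle_form_smult_left

lemma form_pos:
  assumes "p \<noteq> 0"
  shows "B p p > 0"
proof -
  define F where "F = (\<lambda>t. Re (cpoly p (cis t) * cnj (cpoly p (cis t))) * W t)"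
  have int: "integrable half_circle F"
    unfolding F_def by (rule integrable_circle_form[OF integrable_weight])
  have pos: "AE t in half_circle. 0 < F t"
    using weight_pos AE_cpoly_nonzero[OF assms]
    by eventually_elim (auto simp: F_def complex_eq_iff intro!: mult_pos_pos sum_power2_gt_zero_iff[THEN iffD2] simp flip: power2_eq_square)
  then have nonneg: "AE t in half_circle. 0 \<le> F t"
    by eventually_elim simp
  have "integral\<^sup>L half_circle F \<noteq> 0"
  proof
    assume "integral\<^sup>L half_circle F = 0"
    then have "AE t in half_circle. F t = 0"
      using integral_nonneg_eq_0_iff_AE[OF int nonneg] by simp
    with pos have "AE t in half_circle. False"
      by eventually_elim simp
    then show False by (simp add: half_circle.AE_False)
  qed
  moreover have "integral\<^sup>L half_circle F \<ge> 0"
    using nonneg by (rule integral_nonneg_AE)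
  ultimately show ?thesis by (simp add: F_def circle_form_def)
qed

end

text \<open>Szego's recursion for the pair of the monic orthogonal polynomial (first component) and its reversal
(second component). The reversal is carried along instead of being computed from the coefficients, so
that both recursions are linear in the pair. The coefficient \<open>a\<close> is the one that makes the next
polynomial orthogonal to \<open>1\<close>.\<close>

primrec szego_pair :: "(real \<Rightarrow> real) \<Rightarrow> nat \<Rightarrow> real poly \<times> real poly" where
  "szego_pair W 0 = (1, 1)"
| "szego_pair W (Suc n) =
     (let p = fst (szego_pair W n); q = snd (szego_pair W n);
          a = circle_form W (pCons 0 p) 1 / circle_form W p p
      in (pCons 0 p - smult a q, q - smult a (pCons 0 p)))"

definition Phi :: "(real \<Rightarrow> real) \<Rightarrow> nat \<Rightarrow> real poly" where "Phi W n = fst (szego_pair W n)"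
definition Psi :: "(real \<Rightarrow> real) \<Rightarrow> nat \<Rightarrow> real poly" where "Psi W n = snd (szego_pair W n)"
definition verblunsky :: "(real \<Rightarrow> real) \<Rightarrow> nat \<Rightarrow> real" where
  "verblunsky W n = circle_form W (pCons 0 (Phi W n)) 1 / circle_form W (Phi W n) (Phi W n)"

lemma Phi_0 [simp]: "Phi W 0 = 1" and Psi_0 [simp]: "Psi W 0 = 1"
  by (simp_all add: Phi_def Psi_def)

lemma Phi_Suc: "Phi W (Suc n) = pCons 0 (Phi W n) - smult (verblunsky W n) (Psi W n)"
  and Psi_Suc: "Psi W (Suc n) = Psi W n - smult (verblunsky W n) (pCons 0 (Phi W n))"
  by (simp_all add: Phi_def Psi_def verblunsky_def Let_def)

lemma Phi_Psi_degree:
  "degree (Phi W n) \<le> n \<and> coeff (Phi W n) n = 1 \<and> degree (Psi W n) \<le> n \<and> coeff (Psi W n) 0 = 1"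
proof (induction n)
  case (Suc n)
  then have "coeff (Psi W n) (Suc n) = 0" by (simp add: coeff_eq_0)
  with Suc show ?case
    by (auto simp: Phi_Suc Psi_Suc intro!: degree_diff_le order.trans[OF degree_smult_le]
        order.trans[OF degree_pCons_le])
qed simp

lemma degree_Phi: "degree (Phi W n) = n"
  using Phi_Psi_degree[of W n] le_degree[of "Phi W n" n] by auto

text \<open>The reversal: on the circle \<open>\<Psi> n\<close> is \<open>z^n\<close> times the conjugate of \<open>\<Phi> n\<close>, so the two have equal modulus
there and exchange their orthogonality relations.\<close>

lemma Psi_on_circle:
  assumes "norm z = 1"
  shows "cpoly (Psi W n) z = z ^ n * cnj (cpoly (Phi W n) z)"
proof (induction n)
  case (Suc n)
  have "z * cnj z = 1" using complex_norm_square[of z] assms by simp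
  have "z ^ Suc n * cnj (cpoly (Phi W (Suc n)) z) =
      z ^ n * cnj (cpoly (Phi W n) z) * (z * cnj z)
      - verblunsky W n * z * (z ^ n * cnj (cpoly (Psi W n) z))"
    by (simp add: Phi_Suc algebra_simps)
  also have "z ^ n * cnj (cpoly (Psi W n) z) = (z * cnj z) ^ n * cpoly (Phi W n) z"
    unfolding Suc by (simp add: power_mult_distrib)
  finally show ?case
    unfolding \<open>z * cnj z = 1\<close> Suc[symmetric] by (simp add: Psi_Suc)
qed simp

lemma circle_form_Psi_monom:
  assumes "j \<le> n"
  shows "circle_form V (Psi W n) (monom 1 j) = circle_form V (Phi W n) (monom 1 (n - j))"
proof -
  have "Re (cpoly (Psi W n) (cis t) * cnj (cis t ^ j)) = Re (cpoly (Phi W n) (cis t) * cnj (cis t ^ (n - j)))" for t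
  proof -
    have "cis t ^ n = cis t ^ (n - j) * cis t ^ j"
      using assms by (simp flip: power_add)
    then have "cpoly (Psi W n) (cis t) * cnj (cis t ^ j) =
        cis t ^ (n - j) * cnj (cpoly (Phi W n) (cis t)) * (cis t ^ j * cnj (cis t ^ j))"
      by (simp add: Psi_on_circle)
    also have "cis t ^ j * cnj (cis t ^ j) = 1"
      using complex_norm_square[of "cis t ^ j"] by (simp add: norm_power)
    finally have "cpoly (Psi W n) (cis t) * cnj (cis t ^ j) =
        cnj (cpoly (Phi W n) (cis t) * cnj (cis t ^ (n - j)))" by simp
    then show ?thesis by (metis cnj.sel(1))
  qed
  then show ?thesis by (simp add: circle_form_def)
qed

lemma circle_form_Phi_Phi:
  assumes "integrable half_circle V" "\<And>j. j < n \<Longrightarrow> circle_form V (Phi W n) (monom 1 j) = 0"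
  shows "circle_form V (Phi W n) (Phi W n) = circle_form V (Phi W n) (monom 1 n)"
proof -
  have "circle_form V (Phi W n) (Phi W n) =
      (\<Sum>j\<le>n. coeff (Phi W n) j * circle_form V (Phi W n) (monom 1 j))"
    by (subst circle_form_sum_right[OF assms(1)]) (simp add: degree_Phi)
  also have "\<dots> = (\<Sum>j\<in>{n}. coeff (Phi W n) j * circle_form V (Phi W n) (monom 1 j))"
    by (rule sum.mono_neutral_right) (use assms in auto)
  finally show ?thesis using Phi_Psi_degree[of W n] by simp
qed

lemma circle_form_Phi_left:
  assumes "integrable half_circle V"
  shows "circle_form V (Phi W k) q =
    circle_form V (monom 1 k) q + (\<Sum>j<k. coeff (Phi W k) j * circle_form V (monom 1 j) q)"
proof -
  have "circle_form V (Phi W k) q = (\<Sum>j\<le>k. coeff (Phi W k) j * circle_form V (monom 1 j) q)"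
    by (subst circle_form_sum_left[OF assms]) (simp add: degree_Phi)
  then show ?thesis using Phi_Psi_degree[of W k] by (simp flip: lessThan_Suc_atMost)
qed

lemma monom_Suc_shift: "monom (1::real) (Suc j) = pCons 0 (monom 1 j)"
  by (simp add: monom_Suc)

lemma norm_szego_step:
  fixes u v :: complex
  shows "(norm (v - of_real x * u))\<^sup>2 - (norm (u - of_real x * v))\<^sup>2
      = (1 - x\<^sup>2) * ((norm v)\<^sup>2 - (norm u)\<^sup>2)"
proof -
  have "((c - x * a)\<^sup>2 + (d - x * b)\<^sup>2) - ((a - x * c)\<^sup>2 + (b - x * d)\<^sup>2)
        = (1 - x\<^sup>2) * ((c\<^sup>2 + d\<^sup>2) - (a\<^sup>2 + b\<^sup>2))" for a b c d :: real
    by (simp add: power2_eq_square) argo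
  from this[of "Re v" "Re u" "Im v" "Im u"] show ?thesis
    by (simp only: cmod_power2 minus_complex.sel times_complex.sel Re_complex_of_real
        Im_complex_of_real mult_zero_left diff_zero add_0_right)
qed

context circle_weight
begin

abbreviation "\<Phi> \<equiv> Phi W"
abbreviation "\<Psi> \<equiv> Psi W"
abbreviation "\<alpha> \<equiv> verblunsky W"
definition E :: "nat \<Rightarrow> real" where "E n = B (\<Phi> n) (\<Phi> n)"

lemma Phi_nonzero: "\<Phi> n \<noteq> 0"
  using Phi_Psi_degree[of W n] by auto

lemma E_pos: "E n > 0"
  unfolding E_def by (intro form_pos Phi_nonzero)

text \<open>Orthogonality to \<open>z^(i + 1)\<close> is inherited from the induction hypothesis for both \<open>\<Phi> n\<close> (after the shift)
and \<open>\<Psi> n\<close> (after reversal); orthogonality to \<open>1\<close> is the choice of \<open>\<alpha> n\<close>.\<close>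

lemma Phi_orthogonal: "j < n \<Longrightarrow> B (\<Phi> n) (monom 1 j) = 0"
proof (induction n arbitrary: j)
  case (Suc n)
  show ?case
  proof (cases j)
    case 0
    have "B (\<Psi> n) 1 = E n"
      using circle_form_Psi_monom[of 0 n W W] circle_form_Phi_Phi[OF integrable_weight Suc.IH]
      by (simp add: E_def)
    then show ?thesis
      using E_pos[of n] by (simp add: 0 Phi_Suc form_left E_def verblunsky_def)
  next
    case (Suc i)
    then show ?thesis using Suc.prems
      by (simp add: Phi_Suc form_left monom_Suc_shift circle_form_shift Suc.IH
          circle_form_Psi_monom[of "Suc i" n, unfolded monom_Suc_shift])
  qed
qed simp

lemma B_Phi_monom: "B (\<Phi> n) (monom 1 n) = E n"
  unfolding E_def by (rule circle_form_Phi_Phi[OF integrable_weight Phi_orthogonal, symmetric])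

lemma B_Psi_1: "B (\<Psi> n) 1 = E n"
  using circle_form_Psi_monom[of 0 n W W] B_Phi_monom[of n] by simp

text \<open>Positivity of the square norms turns this identity into the bound \<open>|\<alpha> n| < 1\<close>.\<close>

lemma E_Suc: "E (Suc n) = (1 - (\<alpha> n)\<^sup>2) * E n"
proof -
  have "B (pCons 0 (\<Phi> n)) 1 = \<alpha> n * E n"
    using E_pos[of n] by (simp add: verblunsky_def E_def)
  then show ?thesis
    unfolding B_Psi_1[of "Suc n", symmetric] using B_Psi_1[of n]
    by (simp add: Psi_Suc form_left power2_eq_square algebra_simps del: smult_pCons)
qed

lemma verblunsky_sq_less_1: "(\<alpha> n)\<^sup>2 < 1"
proof -
  have "0 < (1 - (\<alpha> n)\<^sup>2) * E n" using E_Suc[of n] E_pos[of "Suc n"] by simp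
  then show ?thesis using E_pos[of n] by (simp add: zero_less_mult_iff)
qed

text \<open>One step of the recursion maps \<open>(u, v)\<close> to \<open>(u - \<alpha> v, v - \<alpha> u)\<close> with \<open>|\<alpha>| < 1\<close>. This is a hyperbolic
rotation up to scaling, so it preserves the order of the moduli. Applied inside the disc with
\<open>u = z \<Phi> n\<close>, \<open>v = \<Psi> n\<close>, and outside with the roles exchanged, it locates all zeros by induction.\<close>

lemma szego_inequality:
  fixes u v :: complex
  assumes "norm u \<le> norm v"
  shows "norm (u - of_real (\<alpha> n) * v) \<le> norm (v - of_real (\<alpha> n) * u)"
proof -
  have "(norm (v - of_real (\<alpha> n) * u))\<^sup>2 - (norm (u - of_real (\<alpha> n) * v))\<^sup>2
      = (1 - (\<alpha> n)\<^sup>2) * ((norm v)\<^sup>2 - (norm u)\<^sup>2)"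
    by (rule norm_szego_step)
  also have "\<dots> \<ge> 0"
    using assms verblunsky_sq_less_1[of n] by (intro mult_nonneg_nonneg) auto
  finally have "(norm (u - of_real (\<alpha> n) * v))\<^sup>2 \<le> (norm (v - of_real (\<alpha> n) * u))\<^sup>2"
    by linarith
  then show ?thesis by (rule power2_le_imp_le) simp
qed

lemma abs_verblunsky_less_1: "\<bar>\<alpha> n\<bar> < 1"
  using verblunsky_sq_less_1[of n] by (simp add: abs_square_less_1)

lemma szego_nonzero:
  fixes u v :: complex
  assumes "norm u \<le> norm v" "v \<noteq> 0"
  shows "v - of_real (\<alpha> n) * u \<noteq> 0"
proof
  assume "v - of_real (\<alpha> n) * u = 0"
  then have "norm v = \<bar>\<alpha> n\<bar> * norm u" by (metis eq_iff_diff_eq_0 norm_mult norm_of_real)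
  also have "\<dots> \<le> \<bar>\<alpha> n\<bar> * norm v" using assms by (intro mult_left_mono) auto
  also have "\<dots> < 1 * norm v" using assms(2) abs_verblunsky_less_1[of n] by (intro mult_strict_right_mono) auto
  finally show False by simp
qed

lemma Psi_in_disc:
  assumes "norm z \<le> 1"
  shows "norm (cpoly (\<Phi> n) z) \<le> norm (cpoly (\<Psi> n) z)" "cpoly (\<Psi> n) z \<noteq> 0"
proof -
  have "norm (cpoly (\<Phi> n) z) \<le> norm (cpoly (\<Psi> n) z) \<and> cpoly (\<Psi> n) z \<noteq> 0"
  proof (induction n)
    case (Suc n)
    have "norm (z * cpoly (\<Phi> n) z) \<le> 1 * norm (cpoly (\<Phi> n) z)"
      unfolding norm_mult using assms by (intro mult_right_mono) auto
    with Suc have "norm (z * cpoly (\<Phi> n) z) \<le> norm (cpoly (\<Psi> n) z)" by simp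
    from szego_inequality[OF this, of n] szego_nonzero[OF this, of n] Suc show ?case
      by (simp add: Phi_Suc Psi_Suc del: smult_pCons)
  qed simp
  then show "norm (cpoly (\<Phi> n) z) \<le> norm (cpoly (\<Psi> n) z)" "cpoly (\<Psi> n) z \<noteq> 0" by auto
qed

lemma Phi_outside_disc:
  assumes "norm z \<ge> 1"
  shows "norm (cpoly (\<Psi> n) z) \<le> norm (cpoly (\<Phi> n) z)" "cpoly (\<Phi> n) z \<noteq> 0"
proof -
  have "norm (cpoly (\<Psi> n) z) \<le> norm (cpoly (\<Phi> n) z) \<and> cpoly (\<Phi> n) z \<noteq> 0"
  proof (induction n)
    case (Suc n)
    have "1 * norm (cpoly (\<Phi> n) z) \<le> norm (z * cpoly (\<Phi> n) z)"
      unfolding norm_mult using assms by (intro mult_right_mono) auto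
    with Suc have le: "norm (cpoly (\<Psi> n) z) \<le> norm (z * cpoly (\<Phi> n) z)" by simp
    have "z * cpoly (\<Phi> n) z \<noteq> 0" using Suc assms by auto
    from szego_inequality[OF le, of n] szego_nonzero[OF le this, of n] show ?case
      by (simp add: Phi_Suc Psi_Suc del: smult_pCons)
  qed simp
  then show "norm (cpoly (\<Psi> n) z) \<le> norm (cpoly (\<Phi> n) z)" "cpoly (\<Phi> n) z \<noteq> 0" by auto
qed

end

section \<open>Bernstein-Szego weights\<close>

context circle_weight
begin

text \<open>The weight \<open>1 / |\<phi> N|^2\<close> for the orthonormal polynomial \<open>\<phi> N = \<Phi> N / sqrt (E N)\<close>.\<close>

definition bernstein_szego :: "nat \<Rightarrow> real \<Rightarrow> real" where
  "bernstein_szego N t = E N / (norm (cpoly (\<Phi> N) (cis t)))\<^sup>2"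

lemma norm_Psi_on_circle: "norm z = 1 \<Longrightarrow> norm (cpoly (\<Psi> n) z) = norm (cpoly (\<Phi> n) z)"
  by (simp add: Psi_on_circle norm_mult norm_power)

lemma Phi_nonzero_on_circle: "norm z = 1 \<Longrightarrow> cpoly (\<Phi> n) z \<noteq> 0"
  by (rule Phi_outside_disc) simp

lemma bernstein_szego_pos: "bernstein_szego N t > 0"
  using E_pos[of N] Phi_nonzero_on_circle[of "cis t" N] by (simp add: bernstein_szego_def)

lemma integrable_bernstein_szego: "integrable half_circle (bernstein_szego N)"
  unfolding bernstein_szego_def
  by (rule integrable_circle[where h = "\<lambda>z. E N / (norm (cpoly (\<Phi> N) z))\<^sup>2"])
    (intro continuous_intros, simp add: Phi_nonzero_on_circle)

text \<open>For the weight \<open>1 / |\<phi> N|^2\<close> the form of \<open>\<Psi> N\<close> and \<open>z^j\<close> is the mean of the real part of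
\<open>E N * z^j / \<Psi> N\<close>, which is holomorphic in the closed disc since \<open>\<Psi> N\<close> has no zeros there.\<close>

lemma bernstein_szego_Psi:
  "circle_form (bernstein_szego N) (\<Psi> N) (monom 1 j) = (if j = 0 then E N else 0)"
proof -
  define f where "f = (\<lambda>z. of_real (E N) * z ^ j / cpoly (\<Psi> N) z)"
  have "Re (cpoly (\<Psi> N) z * cnj (z ^ j)) * (E N / (norm (cpoly (\<Phi> N) z))\<^sup>2) = Re (f z)"
    if "norm z = 1" for z
  proof -
    define P where "P = cpoly (\<Psi> N) z"
    have "P \<noteq> 0" using that Psi_in_disc(2)[of z N] by (simp add: P_def)
    have "cnj (f z) = of_real (E N) * cnj (z ^ j) * P / (P * cnj P)"
      using \<open>P \<noteq> 0\<close> by (simp add: f_def P_def)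
    also have "P * cnj P = of_real ((norm P)\<^sup>2)"
      using complex_norm_square[of P] by simp
    also have "of_real (E N) * cnj (z ^ j) * P / of_real ((norm P)\<^sup>2) =
        of_real (E N / (norm P)\<^sup>2) * (P * cnj (z ^ j))"
      by (simp add: mult_ac)
    finally have "Re (f z) = Re (of_real (E N / (norm P)\<^sup>2) * (P * cnj (z ^ j)))"
      by (metis cnj.sel(1))
    then have "Re (f z) = E N / (norm P)\<^sup>2 * Re (P * cnj (z ^ j))"
      by (simp only: Re_complex_of_real times_complex.sel Im_complex_of_real mult_zero_left diff_zero)
    then show ?thesis
      using norm_Psi_on_circle[OF that, of N] by (simp add: P_def)
  qed
  then have "circle_form (bernstein_szego N) (\<Psi> N) (monom 1 j) = (\<integral>t. Re (f (cis t)) \<partial>half_circle)"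
    by (simp add: circle_form_def bernstein_szego_def del: times_complex.sel)
  also have "\<dots> = Re (f 0)"
  proof (rule mean_value_half_circle)
    show "continuous_on (cball 0 1) f"
      unfolding f_def by (intro continuous_intros) (simp add: Psi_in_disc)
    show "f holomorphic_on ball 0 1"
      unfolding f_def by (intro holomorphic_intros) (simp add: Psi_in_disc)
    show "f (cnj z) = cnj (f z)" for z
      by (simp add: f_def cpoly_cnj)
  qed
  also have "\<dots> = (if j = 0 then E N else 0)"
    using Phi_Psi_degree[of W N] cpoly_of_real[of "\<Psi> N" 0]
    by (simp add: f_def poly_0_coeff_0)
  finally show ?thesis .
qed

lemma inverse_szego:
  "smult (1 - (\<alpha> n)\<^sup>2) (pCons 0 (\<Phi> n)) = \<Phi> (Suc n) + smult (\<alpha> n) (\<Psi> (Suc n))"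
  "smult (1 - (\<alpha> n)\<^sup>2) (\<Psi> n) = \<Psi> (Suc n) + smult (\<alpha> n) (\<Phi> (Suc n))"
  by (simp_all add: Phi_Suc Psi_Suc smult_diff_left smult_diff_right power2_eq_square del: smult_pCons)

text \<open>The recursion can be run backwards with the same coefficients \<open>\<alpha> n\<close>. So the orthogonality relations of the
top pair \<open>\<Phi> N\<close>, \<open>\<Psi> N\<close> with respect to the Bernstein-Szego weight pass down to all lower indices, with
the same square norms as for \<open>W\<close>.\<close>

lemma bernstein_szego_descent:
  assumes "n \<le> N"
  shows "(\<forall>j<n. circle_form (bernstein_szego N) (\<Phi> n) (monom 1 j) = 0) \<and>
    circle_form (bernstein_szego N) (\<Psi> n) 1 = E n"
  using assms
proof (induction n rule: inc_induct)
  case base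
  have "circle_form (bernstein_szego N) (\<Phi> N) (monom 1 j) = 0" if "j < N" for j
    using circle_form_Psi_monom[of "N - j" N "bernstein_szego N" W] that bernstein_szego_Psi[of N "N - j"]
    by simp
  then show ?case using bernstein_szego_Psi[of N 0] by simp
next
  case (step n)
  let ?V = "bernstein_szego N"
  note left = circle_form_add_left[OF integrable_bernstein_szego]
    circle_form_smult_left
  have Phi: "circle_form ?V (\<Phi> (Suc n)) (monom 1 j) = 0" if "j < Suc n" for j
    using step.IH that by blast
  have Psi: "circle_form ?V (\<Psi> (Suc n)) (monom 1 j) = 0" if "1 \<le> j" "j \<le> Suc n" for j
    using that by (simp add: circle_form_Psi_monom Phi)
  have nz: "1 - (\<alpha> n)\<^sup>2 \<noteq> 0" using verblunsky_sq_less_1[of n] by simp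
  have "circle_form ?V (\<Phi> n) (monom 1 j) = 0" if "j < n" for j
  proof -
    have "(1 - (\<alpha> n)\<^sup>2) * circle_form ?V (\<Phi> n) (monom 1 j) =
        circle_form ?V (smult (1 - (\<alpha> n)\<^sup>2) (pCons 0 (\<Phi> n))) (monom 1 (Suc j))"
      unfolding circle_form_smult_left monom_Suc_shift circle_form_shift ..
    also have "\<dots> = 0"
      unfolding inverse_szego left using that by (simp add: Phi Psi)
    finally show ?thesis using nz by simp
  qed
  moreover have "(1 - (\<alpha> n)\<^sup>2) * circle_form ?V (\<Psi> n) 1 = (1 - (\<alpha> n)\<^sup>2) * E n"
  proof -
    have "(1 - (\<alpha> n)\<^sup>2) * circle_form ?V (\<Psi> n) 1 =
        circle_form ?V (smult (1 - (\<alpha> n)\<^sup>2) (\<Psi> n)) 1"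
      unfolding circle_form_smult_left ..
    also have "\<dots> = E (Suc n)"
      unfolding inverse_szego left using step.IH Phi[of 0] by simp
    finally show ?thesis by (simp add: E_Suc)
  qed
  ultimately show ?case using nz by simp
qed

text \<open>Both weights have \<open>\<Phi> k\<close> orthogonal to \<open>1\<close> for \<open>1 \<le> k \<le> N\<close>; as \<open>\<Phi> k\<close> is monic, this determines the
\<open>k\<close>-th moment from the earlier ones.\<close>

lemma bernstein_szego_moments:
  assumes "k \<le> N"
  shows "circle_form (bernstein_szego N) (monom 1 k) 1 = B (monom 1 k) 1"
  using assms
proof (induction k rule: less_induct)
  case (less k)
  have "circle_form (bernstein_szego N) (\<Phi> k) 1 = B (\<Phi> k) 1"
  proof (cases "k = 0")
    case True
    then show ?thesis using bernstein_szego_descent[of 0 N] B_Psi_1[of 0] by simp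
  next
    case False
    then show ?thesis
      using bernstein_szego_descent[OF less.prems] Phi_orthogonal[of 0 k] by auto
  qed
  then show ?case
    using less by (simp add: circle_form_Phi_left integrable_bernstein_szego integrable_weight)
qed

lemma bernstein_szego_norm:
  assumes "n \<le> N"
  shows "circle_form (bernstein_szego N) (\<Phi> n) (\<Phi> n) = E n"
  using bernstein_szego_descent[OF assms] circle_form_Psi_monom[of 0 n "bernstein_szego N" W]
  by (subst circle_form_Phi_Phi[OF integrable_bernstein_szego]) auto

section \<open>Verblunsky coefficients and ratios of orthonormal polynomials\<close>

text \<open>The quotient \<open>|\<phi> n / \<phi> (n + 1)|\<close> of consecutive orthonormal polynomials at the point \<open>cis t\<close>.\<close>

definition ratio :: "nat \<Rightarrow> real \<Rightarrow> real" where
  "ratio n t = sqrt (E (Suc n) / E n) *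
     (norm (cpoly (\<Phi> n) (cis t)) / norm (cpoly (\<Phi> (Suc n)) (cis t)))"

lemma integrable_ratio: "integrable half_circle (ratio n)"
  and integrable_ratio_sq: "integrable half_circle (\<lambda>t. (ratio n t)\<^sup>2)"
  unfolding ratio_def
  by (rule integrable_circle[where h = "\<lambda>z. sqrt (E (Suc n) / E n) *
     (norm (cpoly (\<Phi> n) z) / norm (cpoly (\<Phi> (Suc n)) z))"],
     intro continuous_intros, simp add: Phi_nonzero_on_circle,
    rule integrable_circle[where h = "\<lambda>z. (sqrt (E (Suc n) / E n) *
     (norm (cpoly (\<Phi> n) z) / norm (cpoly (\<Phi> (Suc n)) z)))\<^sup>2"],
     intro continuous_intros, simp add: Phi_nonzero_on_circle)

lemma ratio_nonneg: "ratio n t \<ge> 0"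
  using E_pos[of n] E_pos[of "Suc n"] by (simp add: ratio_def)

text \<open>The mean of \<open>|\<phi> n|^2 / |\<phi> (n + 1)|^2\<close> is the square norm of \<open>\<phi> n\<close> for the next Bernstein-Szego weight, and
this weight gives \<open>\<Phi> n\<close> the square norm that \<open>W\<close> gives it.\<close>

lemma integral_ratio_sq: "(\<integral>t. (ratio n t)\<^sup>2 \<partial>half_circle) = 1"
proof -
  have "(ratio n t)\<^sup>2 = (1 / E n) * (Re (cpoly (\<Phi> n) (cis t) * cnj (cpoly (\<Phi> n) (cis t))) *
      bernstein_szego (Suc n) t)" for t
    using E_pos[of n] E_pos[of "Suc n"]
    by (simp add: ratio_def bernstein_szego_def power_mult_distrib power_divide cmod_power2
        flip: power2_eq_square)
  then have "(\<integral>t. (ratio n t)\<^sup>2 \<partial>half_circle) =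
      (1 / E n) * circle_form (bernstein_szego (Suc n)) (\<Phi> n) (\<Phi> n)"
    unfolding circle_form_def by (simp only: Bochner_Integration.integral_mult_right_zero)
  then show ?thesis
    using E_pos[of n] by (simp add: bernstein_szego_norm)
qed

text \<open>Used with \<open>Y = r * (Re G)^2\<close>. The difference \<open>Y - r * \<tau>^2\<close> is \<open>r * (\<tau>^2 - 1)^2 / 4\<close>, of second order at \<open>\<tau> = 1\<close>; but
for large \<open>\<tau>\<close> \<open>Y\<close> grows like \<open>\<tau>^4\<close>, whose mean is not under control, and the crude bound by \<open>\<tau>^2\<close>
takes over. Keeping the term \<open>r * \<tau>^2\<close> exact matters, because the mean of \<open>\<tau>^2\<close> is known.\<close>

lemma ratio_pointwise:
  fixes r \<tau> Y :: real
  assumes "0 \<le> r" "r \<le> 1" "0 \<le> \<tau>" "Y \<le> \<tau>\<^sup>2" "Y = r * ((1 + \<tau>\<^sup>2) / 2)\<^sup>2"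
  shows "Y \<le> r * \<tau>\<^sup>2 + 4 * (\<tau> - 1)\<^sup>2"
proof (cases "\<tau> \<le> 3")
  case True
  have "Y = r * \<tau>\<^sup>2 + (\<tau> - 1)\<^sup>2 * (r * ((\<tau> + 1) / 2)\<^sup>2)"
    unfolding assms(5) by (simp add: power2_eq_square field_simps)
  moreover have "r * ((\<tau> + 1) / 2)\<^sup>2 \<le> 1 * 2\<^sup>2"
    using assms True by (intro mult_mono power_mono) auto
  then have "(\<tau> - 1)\<^sup>2 * (r * ((\<tau> + 1) / 2)\<^sup>2) \<le> (\<tau> - 1)\<^sup>2 * 4"
    by (intro mult_left_mono) auto
  ultimately show ?thesis by simp
next
  case False
  then have "\<tau>\<^sup>2 \<le> (2 * (\<tau> - 1))\<^sup>2" by (intro power_mono) auto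
  moreover have "0 \<le> r * \<tau>\<^sup>2" using assms by simp
  moreover have "(2 * (\<tau> - 1))\<^sup>2 = 4 * (\<tau> - 1)\<^sup>2" by (simp only: power_mult_distrib) simp
  ultimately show ?thesis using assms(4) by linarith
qed

lemma Re_szego_quotient:
  fixes u v :: complex
  assumes "norm u = norm v" "v - of_real x * u \<noteq> 0"
  shows "Re (v / (v - of_real x * u)) = (1 + (1 - x\<^sup>2) * (norm v / norm (v - of_real x * u))\<^sup>2) / 2"
proof -
  define w where "w = v - of_real x * u"
  have "(norm u)\<^sup>2 = (norm v)\<^sup>2" using assms by simp
  then have uv: "(Re u)\<^sup>2 + (Im u)\<^sup>2 = (Re v)\<^sup>2 + (Im v)\<^sup>2" by (simp add: cmod_power2)
  have w: "Re w = Re v - x * Re u" "Im w = Im v - x * Im u" by (simp_all add: w_def)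
  have pos: "(norm w)\<^sup>2 > 0" using assms by (simp add: w_def)
  have "2 * (Re v * Re w + Im v * Im w) = (norm w)\<^sup>2 + (1 - x\<^sup>2) * (norm v)\<^sup>2"
    unfolding cmod_power2 w using uv by algebra
  then have "Re v * Re w + Im v * Im w = ((norm w)\<^sup>2 + (1 - x\<^sup>2) * (norm v)\<^sup>2) / 2" by simp
  moreover have "Re (v / w) = (Re v * Re w + Im v * Im w) / (norm w)\<^sup>2"
    by (simp add: Re_divide cmod_power2)
  ultimately show ?thesis
    unfolding w_def[symmetric] using pos by (simp add: power_divide field_simps)
qed

text \<open>With \<open>r = 1 - (\<alpha> n)^2\<close> and \<open>G = \<Psi> n / \<Psi> (n + 1)\<close>, the recursion gives \<open>Re G = (1 + \<tau>^2) / 2\<close> and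
\<open>r |G|^2 = \<tau>^2\<close> on the circle. The mean value property \<open>1 = (G 0)^2\<close> turns into
\<open>r + 1 = 2 * mean of r (Re G)^2\<close>. If \<open>\<tau>\<close> is close to \<open>1\<close>, the right side is at most about \<open>2 r\<close>, so \<open>r\<close> must be
close to \<open>1\<close>.\<close>

lemma verblunsky_sq_le: "(\<alpha> n)\<^sup>2 \<le> 16 * (1 - integral\<^sup>L half_circle (ratio n))"
proof -
  define G where "G = (\<lambda>z. cpoly (\<Psi> n) z / cpoly (\<Psi> (Suc n)) z)"
  define r where "r = 1 - (\<alpha> n)\<^sup>2"
  have r: "0 < r" "r \<le> 1" using verblunsky_sq_less_1[of n] by (auto simp: r_def)
  have r_eq: "r = E (Suc n) / E n" using E_Suc[of n] E_pos[of n] by (simp add: r_def)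
  have contG: "continuous_on (cball 0 1) G" unfolding G_def
    by (intro continuous_intros) (simp add: Psi_in_disc)
  then have contG': "continuous_on (sphere 0 1) G"
    by (rule continuous_on_subset) auto
  have mean: "(\<integral>t. Re ((G (cis t))\<^sup>2) \<partial>half_circle) = 1"
  proof -
    have "(\<integral>t. Re ((G (cis t))\<^sup>2) \<partial>half_circle) = Re ((G 0)\<^sup>2)"
    proof (rule mean_value_half_circle[where f = "\<lambda>z. (G z)\<^sup>2"])
      show "continuous_on (cball 0 1) (\<lambda>z. (G z)\<^sup>2)" by (intro continuous_intros contG)
      show "(\<lambda>z. (G z)\<^sup>2) holomorphic_on ball 0 1" unfolding G_def
        by (intro holomorphic_intros) (simp add: Psi_in_disc)
      show "(G (cnj z))\<^sup>2 = cnj ((G z)\<^sup>2)" for z by (simp add: G_def cpoly_cnj)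
    qed
    moreover have "cpoly (\<Psi> k) 0 = 1" for k
      using Phi_Psi_degree[of W k] cpoly_of_real[of "\<Psi> k" 0] by (simp add: poly_0_coeff_0)
    ultimately show ?thesis by (simp add: G_def)
  qed
  have normG: "r * (norm (G (cis t)))\<^sup>2 = (ratio n t)\<^sup>2" for t
    using E_pos[of n] E_pos[of "Suc n"]
    by (simp add: G_def norm_divide norm_Psi_on_circle ratio_def power_mult_distrib power_divide r_eq)
  have ReG: "Re (G (cis t)) = (1 + (ratio n t)\<^sup>2) / 2" for t
  proof -
    let ?v = "cpoly (\<Psi> n) (cis t)" and ?u = "cis t * cpoly (\<Phi> n) (cis t)"
    have eq: "cpoly (\<Psi> (Suc n)) (cis t) = ?v - of_real (\<alpha> n) * ?u"
      by (simp add: Psi_Suc del: smult_pCons)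
    have "Re (?v / (?v - of_real (\<alpha> n) * ?u)) =
        (1 + (1 - (\<alpha> n)\<^sup>2) * (norm ?v / norm (?v - of_real (\<alpha> n) * ?u))\<^sup>2) / 2"
      by (rule Re_szego_quotient)
        (use Psi_in_disc(2)[of "cis t" "Suc n"] in \<open>simp_all add: norm_mult norm_Psi_on_circle flip: eq\<close>)
    then show ?thesis
      unfolding eq[symmetric] normG[of t, symmetric] by (simp add: G_def norm_divide r_def)
  qed
  define X where "X = (\<lambda>t. Re (G (cis t)))"
  have intX: "integrable half_circle (\<lambda>t. (X t)\<^sup>2)"
    unfolding X_def
    by (rule integrable_circle[where h = "\<lambda>z. (Re (G z))\<^sup>2"]) (intro continuous_intros contG')
  have ReG2: "r * Re ((G (cis t))\<^sup>2) = 2 * (r * (X t)\<^sup>2) - (ratio n t)\<^sup>2" for t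
  proof -
    have "Re ((G (cis t))\<^sup>2) = 2 * (X t)\<^sup>2 - (norm (G (cis t)))\<^sup>2"
      unfolding X_def cmod_power2 by (simp add: power2_eq_square)
    then show ?thesis by (simp only: normG[symmetric]) (simp add: right_diff_distrib)
  qed
  have "r = (\<integral>t. r * Re ((G (cis t))\<^sup>2) \<partial>half_circle)" using mean by simp
  also have "\<dots> = 2 * (\<integral>t. r * (X t)\<^sup>2 \<partial>half_circle) - 1"
    unfolding ReG2 using intX integral_ratio_sq[of n] integrable_ratio_sq[of n]
    by (subst Bochner_Integration.integral_diff) auto
  finally have 1: "r + 1 = 2 * (\<integral>t. r * (X t)\<^sup>2 \<partial>half_circle)" by simp
  have "(\<integral>t. r * (X t)\<^sup>2 \<partial>half_circle) \<le>
      (\<integral>t. r * (ratio n t)\<^sup>2 + 4 * ((ratio n t)\<^sup>2 - 2 * ratio n t + 1) \<partial>half_circle)"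
  proof (rule integral_mono)
    show "integrable half_circle (\<lambda>t. r * (X t)\<^sup>2)" using intX by simp
    show "integrable half_circle (\<lambda>t. r * (ratio n t)\<^sup>2 + 4 * ((ratio n t)\<^sup>2 - 2 * ratio n t + 1))"
      using integrable_ratio[of n] integrable_ratio_sq[of n] by simp
    fix t
    have "(X t)\<^sup>2 \<le> (norm (G (cis t)))\<^sup>2"
      by (simp add: X_def cmod_power2)
    then have "r * (X t)\<^sup>2 \<le> (ratio n t)\<^sup>2"
      using r by (simp flip: normG)
    then have "r * (X t)\<^sup>2 \<le> r * (ratio n t)\<^sup>2 + 4 * (ratio n t - 1)\<^sup>2"
      using r by (intro ratio_pointwise ratio_nonneg) (auto simp: X_def ReG)
    then show "r * (X t)\<^sup>2 \<le> r * (ratio n t)\<^sup>2 + 4 * ((ratio n t)\<^sup>2 - 2 * ratio n t + 1)"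
      by (simp add: power2_diff)
  qed
  also have "\<dots> = r + 8 * (1 - integral\<^sup>L half_circle (ratio n))"
    using integrable_ratio[of n] integrable_ratio_sq[of n] integral_ratio_sq[of n] by simp
  finally show ?thesis using 1 by (simp add: r_def)
qed

end

section \<open>Vanishing of the Verblunsky coefficients\<close>

lemma integrable_cos_moment:
  assumes "integrable half_circle U"
  shows "integrable half_circle (\<lambda>t. (cos t ^ j * cos (real k * t)) * U t)"
proof (rule integrable_bounded_mult[OF _ _ assms])
  fix t :: real
  have "\<bar>cos t\<bar> ^ j \<le> 1" by (intro power_le_one) auto
  then have "\<bar>cos t ^ j\<bar> * \<bar>cos (real k * t)\<bar> \<le> 1 * 1" unfolding power_abs by (intro mult_mono) auto
  then show "\<bar>cos t ^ j * cos (real k * t)\<bar> \<le> 1" by (simp add: abs_mult)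
qed measurable

lemma circle_form_monom_1: "circle_form U (monom 1 k) 1 = (\<integral>t. cos (real k * t) * U t \<partial>half_circle)"
proof -
  have "Re (cis t ^ k) = cos (real k * t)" for t
    by (simp add: Complex.DeMoivre del: times_complex.sel)
  then show ?thesis by (simp add: circle_form_def)
qed

context circle_weight
begin

text \<open>The product formula for cosines trades a factor \<open>cos t\<close> for a shift of the frequency \<open>k\<close> by one, so
everything reduces to the moments, that is to \<open>j = 0\<close>.\<close>

lemma bernstein_szego_cos_moments:
  "j + k \<le> N \<Longrightarrow> (\<integral>t. (cos t ^ j * cos (real k * t)) * bernstein_szego N t \<partial>half_circle) =
     (\<integral>t. (cos t ^ j * cos (real k * t)) * W t \<partial>half_circle)"
proof (induction j arbitrary: k)
  case 0
  then show ?case using bernstein_szego_moments[of k N] by (simp add: circle_form_monom_1)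
next
  case (Suc j)
  show ?case
  proof (cases k)
    case 0
    then show ?thesis using Suc.IH[of 1] Suc.prems by (simp add: mult_ac)
  next
    case (Suc i)
    have eq: "(cos t ^ Suc j * cos (real k * t)) * U =
        ((cos t ^ j * cos (real (i + 2) * t)) * U + (cos t ^ j * cos (real i * t)) * U) / 2" for t U
    proof -
      have a: "real (i + 2) * t = real k * t + t" "real i * t = real k * t - t"
        by (simp_all add: Suc algebra_simps)
      show ?thesis unfolding a by (simp add: cos_add cos_diff algebra_simps)
    qed
    have "(\<integral>t. (cos t ^ Suc j * cos (real k * t)) * U t \<partial>half_circle) =
      ((\<integral>t. (cos t ^ j * cos (real (i + 2) * t)) * U t \<partial>half_circle) +
       (\<integral>t. (cos t ^ j * cos (real i * t)) * U t \<partial>half_circle)) / 2"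
      if "integrable half_circle U" for U
      unfolding eq using integrable_cos_moment[OF that, of j "i + 2"] integrable_cos_moment[OF that, of j i]
      by (simp only: integral_divide_zero Bochner_Integration.integral_add)
    note split = this
    have "j + (i + 2) \<le> N" "j + i \<le> N" using Suc.prems Suc by auto
    from Suc.IH[OF this(1)] Suc.IH[OF this(2)] show ?thesis
      unfolding split[OF integrable_weight] split[OF integrable_bernstein_szego] by (simp only:)
  qed
qed

lemma bernstein_szego_polynomial:
  assumes "d \<le> N"
  shows "(\<integral>t. (\<Sum>i\<le>d. a i * cos t ^ i) * bernstein_szego N t \<partial>half_circle) =
    (\<integral>t. (\<Sum>i\<le>d. a i * cos t ^ i) * W t \<partial>half_circle)"
proof -
  have int: "integrable half_circle (\<lambda>t. cos t ^ i * U t)" if "integrable half_circle U" for U i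
    using integrable_cos_moment[OF that, of i 0] by simp
  have "(\<integral>t. (\<Sum>i\<le>d. a i * cos t ^ i) * U t \<partial>half_circle) =
      (\<Sum>i\<le>d. a i * (\<integral>t. cos t ^ i * U t \<partial>half_circle))"
    if "integrable half_circle U" for U
    using int[OF that] by (simp add: sum_distrib_right mult.assoc Bochner_Integration.integral_sum)
  moreover have "(\<integral>t. cos t ^ i * bernstein_szego N t \<partial>half_circle) =
      (\<integral>t. cos t ^ i * W t \<partial>half_circle)" if "i \<le> d" for i
    using bernstein_szego_cos_moments[of i 0 N] that assms by simp
  ultimately show ?thesis
    using integrable_bernstein_szego integrable_weight by simp
qed

lemma total_mass: "integral\<^sup>L half_circle W = E 0" "integral\<^sup>L half_circle (bernstein_szego N) = E 0"
proof -
  show W: "integral\<^sup>L half_circle W = E 0"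
    by (simp add: E_def circle_form_def)
  show "integral\<^sup>L half_circle (bernstein_szego N) = E 0"
    using bernstein_szego_cos_moments[of 0 0 N] W by simp
qed

text \<open>Integrals of polynomials in \<open>cos t\<close> are eventually constant. As all the weights have the same total mass,
Weierstrass approximation extends the convergence to continuous functions.\<close>

lemma bernstein_szego_weak_convergence:
  assumes cont: "continuous_on UNIV F" and bound: "\<And>t. \<bar>F t\<bar> \<le> C"
  shows "(\<lambda>n. \<integral>t. F t * bernstein_szego n t \<partial>half_circle) \<longlonglongrightarrow> (\<integral>t. F t * W t \<partial>half_circle)"
proof (rule LIMSEQ_I)
  fix e :: real assume "e > 0"
  \<comment> \<open>\<open>E 0\<close> is the total mass of every weight involved, so an error \<open>d\<close> in \<open>F\<close> costs \<open>e / 3\<close>.\<close>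
  define d where "d = e / (3 * E 0)"
  have "d > 0" using \<open>e > 0\<close> E_pos[of 0] by (simp add: d_def)
  have "continuous_on {-1..1} (\<lambda>x. F (arccos x))"
    by (intro continuous_on_compose2[OF cont] continuous_intros) auto
  then obtain g where "real_polynomial_function g"
    and g: "\<And>x. x \<in> {-1..1} \<Longrightarrow> \<bar>F (arccos x) - g x\<bar> < d"
    using Stone_Weierstrass_real_polynomial_function[of "{-1..1::real}" _ d] \<open>d > 0\<close> by blast
  then obtain a m where "g = (\<lambda>x. \<Sum>i\<le>m. a i * x ^ i)"
    unfolding real_polynomial_function_iff_sum by blast
  define p where "p = (\<lambda>t. \<Sum>i\<le>m. a i * cos t ^ i)"
  have close: "\<bar>F t - p t\<bar> \<le> d" if "t \<in> {0..pi}" for t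
    using g[of "cos t"] that by (simp add: \<open>g = _\<close> p_def arccos_cos less_imp_le)
  have [measurable]: "F \<in> borel_measurable borel"
    by (rule borel_measurable_continuous_onI[OF cont])
  have diff: "\<bar>(\<integral>t. F t * U t \<partial>half_circle) - (\<integral>t. p t * U t \<partial>half_circle)\<bar> \<le> d * E 0"
    if U: "integrable half_circle U" "AE t in half_circle. 0 < U t" "integral\<^sup>L half_circle U = E 0" for U
  proof -
    have intF: "integrable half_circle (\<lambda>t. F t * U t)"
      by (rule integrable_bounded_mult[OF _ bound U(1)]) measurable
    have intp: "integrable half_circle (\<lambda>t. p t * U t)"
      using integrable_cos_moment[OF U(1), of _ 0] by (simp add: p_def sum_distrib_right mult.assoc)
    have AE01: "AE t in half_circle. t \<in> {0..pi}" by (simp add: AE_half_circle)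
    have "\<bar>\<integral>t. F t * U t - p t * U t \<partial>half_circle\<bar> \<le> (\<integral>t. \<bar>F t * U t - p t * U t\<bar> \<partial>half_circle)"
      by (rule integral_abs_bound)
    also have "\<dots> \<le> (\<integral>t. d * U t \<partial>half_circle)"
    proof (rule integral_mono_AE)
      show "AE t in half_circle. \<bar>F t * U t - p t * U t\<bar> \<le> d * U t"
        using U(2) AE01
      proof eventually_elim
        case (elim t)
        then show ?case using close[of t]
          by (auto simp: abs_mult simp flip: left_diff_distrib)
      qed
    qed (use intF intp U(1) in auto)
    finally show ?thesis using intF intp U(3) by simp
  qed
  have "\<bar>(\<integral>t. F t * bernstein_szego n t \<partial>half_circle) - (\<integral>t. F t * W t \<partial>half_circle)\<bar> < e" if "n \<ge> m" for n
  proof -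
    have "(\<integral>t. p t * bernstein_szego n t \<partial>half_circle) = (\<integral>t. p t * W t \<partial>half_circle)"
      unfolding p_def by (rule bernstein_szego_polynomial[OF that])
    moreover have "d * E 0 = e / 3" using E_pos[of 0] by (simp add: d_def)
    moreover have "\<bar>(\<integral>t. F t * W t \<partial>half_circle) - (\<integral>t. p t * W t \<partial>half_circle)\<bar> \<le> d * E 0"
      by (rule diff[OF integrable_weight weight_pos total_mass(1)])
    moreover have "\<bar>(\<integral>t. F t * bernstein_szego n t \<partial>half_circle) -
        (\<integral>t. p t * bernstein_szego n t \<partial>half_circle)\<bar> \<le> d * E 0"
      by (rule diff[OF integrable_bernstein_szego _ total_mass(2)]) (simp add: bernstein_szego_pos)
    ultimately show ?thesis
      using \<open>e > 0\<close> by linarith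
  qed
  then show "\<exists>no. \<forall>n\<ge>no. norm ((\<integral>t. F t * bernstein_szego n t \<partial>half_circle) - (\<integral>t. F t * W t \<partial>half_circle)) < e"
    by auto
qed

lemma weight_measurable [measurable]: "W \<in> borel_measurable borel"
  using borel_measurable_integrable[OF integrable_weight] by (simp cong: measurable_cong_sets)

lemma integrable_fourth_root:
  assumes [measurable]: "F \<in> borel_measurable borel" and F: "\<And>t. 0 \<le> F t" "\<And>t. F t \<le> K"
  shows "integrable half_circle (\<lambda>t. sqrt (F t * sqrt (W t)))"
    "AE t in half_circle. norm (sqrt (F t * sqrt (W t))) \<le> K + W t + 1"
proof -
  show bound: "AE t in half_circle. norm (sqrt (F t * sqrt (W t))) \<le> K + W t + 1"
    using weight_pos
  proof eventually_elim
    case (elim t)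
    have "sqrt (F t * sqrt (W t)) \<le> (F t + sqrt (W t)) / 2"
      using F(1)[of t] elim by (intro arith_geo_mean_sqrt) auto
    moreover have "sqrt (W t * 1) \<le> (W t + 1) / 2"
      using elim by (intro arith_geo_mean_sqrt) auto
    ultimately have "sqrt (F t * sqrt (W t)) \<le> K + W t + 1"
      using F[of t] elim by (simp add: field_simps)
    then show ?case using F(1)[of t] elim by simp
  qed
  show "integrable half_circle (\<lambda>t. sqrt (F t * sqrt (W t)))"
  proof (rule Bochner_Integration.integrable_bound)
    show "integrable half_circle (\<lambda>t. K + W t + 1)" using integrable_weight by simp
    show "AE t in half_circle. norm (sqrt (F t * sqrt (W t))) \<le> norm (K + W t + 1)"
      using bound by eventually_elim simp
  qed measurable
qed

text \<open>For the untruncated function \<open>1 / sqrt W\<close> both integrands are \<open>1\<close> almost everywhere. Truncation at a large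
\<open>k\<close> makes the function bounded and loses little.\<close>

lemma truncated_inverse_sqrt_weight:
  assumes "e > 0"
  obtains k :: nat where
    "(\<integral>t. (min (1 / sqrt (W t)) k)\<^sup>2 * W t \<partial>half_circle) \<le> 1"
    "(\<integral>t. sqrt (min (1 / sqrt (W t)) k * sqrt (W t)) \<partial>half_circle) > 1 - e"
proof -
  have "(\<lambda>k::nat. \<integral>t. sqrt (min (1 / sqrt (W t)) k * sqrt (W t)) \<partial>half_circle) \<longlonglongrightarrow> (\<integral>t. 1 \<partial>half_circle)"
  proof (rule integral_dominated_convergence[where w = "\<lambda>_. 1"])
    show "AE t in half_circle. (\<lambda>k::nat. sqrt (min (1 / sqrt (W t)) k * sqrt (W t))) \<longlonglongrightarrow> 1"
      using weight_pos
    proof eventually_elim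
      case (elim t)
      have "sqrt (min (1 / sqrt (W t)) k * sqrt (W t)) = 1" if "k \<ge> nat \<lceil>1 / sqrt (W t)\<rceil>" for k :: nat
      proof -
        have "1 / sqrt (W t) \<le> k" using that by linarith
        then have "min (1 / sqrt (W t)) k = 1 / sqrt (W t)" by simp
        then show ?thesis using elim by simp
      qed
      then show ?case
        by (intro tendsto_eventually eventually_sequentiallyI)
    qed
    show "AE t in half_circle. norm (sqrt (min (1 / sqrt (W t)) k * sqrt (W t))) \<le> 1" for k :: nat
      using weight_pos
    proof eventually_elim
      case (elim t)
      have "min (1 / sqrt (W t)) k * sqrt (W t) \<le> 1 / sqrt (W t) * sqrt (W t)"
        using elim by (intro mult_right_mono) auto
      then show ?case using elim by simp
    qed
  qed auto
  then have "\<forall>\<^sub>F k::nat in sequentially. (\<integral>t. sqrt (min (1 / sqrt (W t)) k * sqrt (W t)) \<partial>half_circle) > 1 - e"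
    by (rule order_tendstoD) (use assms half_circle.prob_space in simp)
  from eventually_happens'[OF sequentially_bot this] obtain k :: nat
    where k: "(\<integral>t. sqrt (min (1 / sqrt (W t)) k * sqrt (W t)) \<partial>half_circle) > 1 - e"
    by blast
  have "(\<integral>t. (min (1 / sqrt (W t)) k)\<^sup>2 * W t \<partial>half_circle) \<le> (\<integral>t. 1 \<partial>half_circle)"
  proof (rule integral_mono_AE')
    show "AE t in half_circle. (min (1 / sqrt (W t)) k)\<^sup>2 * W t \<le> 1"
      using weight_pos
    proof eventually_elim
      case (elim t)
      have "(min (1 / sqrt (W t)) k)\<^sup>2 * W t \<le> (1 / sqrt (W t))\<^sup>2 * W t"
        using elim by (intro mult_right_mono power_mono) auto
      then show ?case using elim by (simp add: power_divide)
    qed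
  qed auto
  then show ?thesis using that k half_circle.prob_space by simp
qed

text \<open>A measurable function is the limit almost everywhere of continuous ones; truncating those keeps them
dominated, and both integrals converge.\<close>

lemma approximate_inverse_sqrt_weight:
  assumes "e > 0"
  obtains F K where "continuous_on UNIV F" "\<And>t. 0 \<le> F t" "\<And>t. F t \<le> K"
    "(\<integral>t. (F t)\<^sup>2 * W t \<partial>half_circle) < 1 + e"
    "(\<integral>t. sqrt (F t * sqrt (W t)) \<partial>half_circle) > 1 - e"
proof -
  define f where "f = (\<lambda>t. 1 / sqrt (W t))"
  obtain k :: nat where k: "(\<integral>t. (min (f t) k)\<^sup>2 * W t \<partial>half_circle) \<le> 1"
    "(\<integral>t. sqrt (min (f t) k * sqrt (W t)) \<partial>half_circle) > 1 - e"
    unfolding f_def by (rule truncated_inverse_sqrt_weight[OF assms])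
  have [measurable]: "f \<in> borel_measurable borel" unfolding f_def by measurable
  then have "f \<in> borel_measurable lebesgue" by (intro measurable_completion) simp
  then have "f measurable_on UNIV" by (rule lebesgue_measurable_imp_measurable_on) simp
  then obtain N g where N: "negligible N" and g: "\<And>n. continuous_on UNIV (g n)"
    "\<And>x. x \<notin> N \<Longrightarrow> (\<lambda>n. g n x) \<longlonglongrightarrow> f x"
    unfolding measurable_on_def by auto
  have [measurable]: "g n \<in> borel_measurable borel" for n
    by (rule borel_measurable_continuous_onI[OF g(1)])
  have "AE t in lebesgue. (\<lambda>n. g n t) \<longlonglongrightarrow> f t"
    by (rule AE_I'[of N]) (use N g(2) in \<open>auto simp: negligible_iff_null_sets\<close>)
  then have "AE t in half_circle. (\<lambda>n. g n t) \<longlonglongrightarrow> f t"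
    unfolding AE_completion_iff AE_half_circle by auto
  define F where "F = (\<lambda>n t. max 0 (min (g n t) (real k)))"
  have [measurable]: "F n \<in> borel_measurable borel" for n
    unfolding F_def by measurable
  have F01: "0 \<le> F n t" "F n t \<le> real k" for n t by (auto simp: F_def)
  have lim: "AE t in half_circle. (\<lambda>n. F n t) \<longlonglongrightarrow> min (f t) k"
    using weight_pos \<open>AE t in half_circle. (\<lambda>n. g n t) \<longlonglongrightarrow> f t\<close>
  proof eventually_elim
    case (elim t)
    then have "(\<lambda>n. F n t) \<longlonglongrightarrow> max 0 (min (f t) (real k))"
      unfolding F_def by (intro tendsto_intros)
    then show ?case using elim by (simp add: f_def)
  qed
  have "(\<lambda>n. \<integral>t. (F n t)\<^sup>2 * W t \<partial>half_circle) \<longlonglongrightarrow> (\<integral>t. (min (f t) k)\<^sup>2 * W t \<partial>half_circle)"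
  proof (rule integral_dominated_convergence[where w = "\<lambda>t. (real k)\<^sup>2 * W t"])
    show "AE t in half_circle. (\<lambda>n. (F n t)\<^sup>2 * W t) \<longlonglongrightarrow> (min (f t) k)\<^sup>2 * W t"
      using lim by eventually_elim (intro tendsto_intros)
    show "AE t in half_circle. norm ((F n t)\<^sup>2 * W t) \<le> (real k)\<^sup>2 * W t" for n
      using weight_pos by eventually_elim (use F01 in \<open>auto simp: abs_mult intro!: mult_right_mono power_mono\<close>)
  qed (use integrable_weight in auto)
  then have "\<forall>\<^sub>F n in sequentially. (\<integral>t. (F n t)\<^sup>2 * W t \<partial>half_circle) < 1 + e"
    by (rule order_tendstoD) (use k assms in linarith)
  moreover have "(\<lambda>n. \<integral>t. sqrt (F n t * sqrt (W t)) \<partial>half_circle) \<longlonglongrightarrow> (\<integral>t. sqrt (min (f t) k * sqrt (W t)) \<partial>half_circle)"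
  proof (rule integral_dominated_convergence[where w = "\<lambda>t. k + W t + 1"])
    show "AE t in half_circle. (\<lambda>n. sqrt (F n t * sqrt (W t))) \<longlonglongrightarrow> sqrt (min (f t) k * sqrt (W t))"
      using lim by eventually_elim (intro tendsto_intros)
    show "AE t in half_circle. norm (sqrt (F n t * sqrt (W t))) \<le> k + W t + 1" for n
      by (rule integrable_fourth_root(2)) (auto simp: F01)
  qed (use integrable_weight in auto)
  then have "\<forall>\<^sub>F n in sequentially. (\<integral>t. sqrt (F n t * sqrt (W t)) \<partial>half_circle) > 1 - e"
    by (rule order_tendstoD) (rule k(2))
  ultimately have "\<forall>\<^sub>F n in sequentially. (\<integral>t. (F n t)\<^sup>2 * W t \<partial>half_circle) < 1 + e \<and>
      (\<integral>t. sqrt (F n t * sqrt (W t)) \<partial>half_circle) > 1 - e"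
    by eventually_elim simp
  from eventually_happens'[OF sequentially_bot this] obtain n
    where "(\<integral>t. (F n t)\<^sup>2 * W t \<partial>half_circle) < 1 + e"
      "(\<integral>t. sqrt (F n t * sqrt (W t)) \<partial>half_circle) > 1 - e"
    by blast
  moreover have "continuous_on UNIV (F n)"
    unfolding F_def by (intro continuous_intros g)
  ultimately show ?thesis using that F01 by blast
qed

text \<open>With \<open>Y = |\<phi> (n + 1)|^2 W\<close> and \<open>Z = F^2 / |\<phi> n|^2\<close> the polynomials cancel in
\<open>\<tau>^2 Y Z = F^2 W\<close>; the bound is two applications of the arithmetic-geometric mean inequality.\<close>

lemma fourth_root_le_ratio:
  assumes "0 < W t" "0 \<le> F t"
  shows "sqrt (F t * sqrt (W t)) \<le> ratio n t / 2
    + (norm (cpoly (\<Phi> (Suc n)) (cis t)))\<^sup>2 * W t / E (Suc n) / 4 + (F t)\<^sup>2 * bernstein_szego n t / 4"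
proof -
  define A where "A = norm (cpoly (\<Phi> n) (cis t))"
  define A' where "A' = norm (cpoly (\<Phi> (Suc n)) (cis t))"
  have A: "A > 0" "A' > 0" using Phi_nonzero_on_circle[of "cis t"] by (simp_all add: A_def A'_def)
  define Y where "Y = A'\<^sup>2 * W t / E (Suc n)"
  define Z where "Z = (F t)\<^sup>2 * bernstein_szego n t"
  have nn: "0 \<le> Y" "0 \<le> Z" using assms E_pos[of "Suc n"] bernstein_szego_pos[of n t]
    by (simp_all add: Y_def Z_def)
  have "(ratio n t)\<^sup>2 * (Y * Z) = (F t)\<^sup>2 * W t"
    using A E_pos[of n] E_pos[of "Suc n"]
    by (simp add: ratio_def Y_def Z_def bernstein_szego_def power_mult_distrib power_divide
        flip: A_def A'_def)
  then have "sqrt ((ratio n t)\<^sup>2 * (Y * Z)) = sqrt ((F t)\<^sup>2 * W t)" by simp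
  then have "F t * sqrt (W t) = ratio n t * sqrt (Y * Z)"
    using assms ratio_nonneg[of n t] by (simp add: real_sqrt_mult)
  moreover have "sqrt (ratio n t * sqrt (Y * Z)) \<le> (ratio n t + sqrt (Y * Z)) / 2"
    using nn by (intro arith_geo_mean_sqrt ratio_nonneg real_sqrt_ge_zero mult_nonneg_nonneg)
  moreover have "sqrt (Y * Z) \<le> (Y + Z) / 2"
    using nn by (intro arith_geo_mean_sqrt)
  ultimately show ?thesis
    unfolding Y_def[symmetric, unfolded A'_def] Z_def[symmetric] by simp
qed

text \<open>As the mean of \<open>\<tau>^2\<close> is \<open>1\<close>, the mean of \<open>\<tau>\<close> is at most \<open>1\<close>; this lower bound says that it tends to \<open>1\<close>.\<close>

lemma eventually_integral_ratio:
  assumes "e > 0"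
  shows "\<forall>\<^sub>F n in sequentially. integral\<^sup>L half_circle (ratio n) > 1 - 3 * e"
proof -
  obtain F K where F: "continuous_on UNIV F" "\<And>t. 0 \<le> F t" "\<And>t. F t \<le> K"
    "(\<integral>t. (F t)\<^sup>2 * W t \<partial>half_circle) < 1 + e"
    "(\<integral>t. sqrt (F t * sqrt (W t)) \<partial>half_circle) > 1 - e"
    using approximate_inverse_sqrt_weight[OF assms] by blast
  have [measurable]: "F \<in> borel_measurable borel"
    by (rule borel_measurable_continuous_onI[OF F(1)])
  have F2: "\<bar>(F t)\<^sup>2\<bar> \<le> K\<^sup>2" for t using F(2,3) by (simp add: power_mono)
  have "(\<lambda>n. \<integral>t. (F t)\<^sup>2 * bernstein_szego n t \<partial>half_circle) \<longlonglongrightarrow> (\<integral>t. (F t)\<^sup>2 * W t \<partial>half_circle)"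
    by (rule bernstein_szego_weak_convergence[OF _ F2]) (intro continuous_intros F)
  then have "\<forall>\<^sub>F n in sequentially. (\<integral>t. (F t)\<^sup>2 * bernstein_szego n t \<partial>half_circle) < 1 + e"
    by (rule order_tendstoD) (rule F)
  then show ?thesis
  proof eventually_elim
    case (elim n)
    let ?Y = "\<lambda>t. (norm (cpoly (\<Phi> (Suc n)) (cis t)))\<^sup>2 * W t"
    let ?Z = "\<lambda>t. (F t)\<^sup>2 * bernstein_szego n t"
    have "?Y = (\<lambda>t. Re (cpoly (\<Phi> (Suc n)) (cis t) * cnj (cpoly (\<Phi> (Suc n)) (cis t))) * W t)"
      by (simp add: cmod_power2 flip: power2_eq_square)
    then have Y: "integrable half_circle ?Y" "integral\<^sup>L half_circle ?Y = E (Suc n)"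
      using integrable_circle_form[OF integrable_weight, of "\<Phi> (Suc n)" "\<Phi> (Suc n)"]
      by (simp_all only: E_def circle_form_def)
    have Z: "integrable half_circle ?Z"
      by (rule integrable_bounded_mult[OF _ F2 integrable_bernstein_szego]) measurable
    have "1 - e < (\<integral>t. sqrt (F t * sqrt (W t)) \<partial>half_circle)" by (rule F)
    also have "\<dots> \<le> (\<integral>t. ratio n t / 2 + ?Y t / E (Suc n) / 4 + ?Z t / 4 \<partial>half_circle)"
    proof (rule integral_mono_AE)
      show "integrable half_circle (\<lambda>t. sqrt (F t * sqrt (W t)))"
        by (rule integrable_fourth_root(1)) (use F in auto)
      show "AE t in half_circle. sqrt (F t * sqrt (W t)) \<le> ratio n t / 2 + ?Y t / E (Suc n) / 4 + ?Z t / 4"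
        using weight_pos by eventually_elim (intro fourth_root_le_ratio F)
    qed (use Y Z integrable_ratio in auto)
    also have "\<dots> = integral\<^sup>L half_circle (ratio n) / 2 + 1 / 4 + (\<integral>t. ?Z t \<partial>half_circle) / 4"
      using Y Z integrable_ratio[of n] E_pos[of "Suc n"] by simp
    finally show ?case using elim assms by linarith
  qed
qed

lemma verblunsky_tendsto_0: "\<alpha> \<longlonglongrightarrow> 0"
proof -
  have "(\<lambda>n. (\<alpha> n)\<^sup>2) \<longlonglongrightarrow> 0"
  proof (rule order_tendstoI)
    fix e :: real assume "0 < e"
    then have "\<forall>\<^sub>F n in sequentially. integral\<^sup>L half_circle (ratio n) > 1 - 3 * (e / 48)"
      by (intro eventually_integral_ratio) simp
    then show "\<forall>\<^sub>F n in sequentially. (\<alpha> n)\<^sup>2 < e"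
    proof eventually_elim
      case (elim n)
      then show ?case using verblunsky_sq_le[of n] by argo
    qed
  next
    fix e :: real assume "e < 0"
    then have "e < (\<alpha> n)\<^sup>2" for n using zero_le_power2[of "\<alpha> n"] by linarith
    then show "\<forall>\<^sub>F n in sequentially. e < (\<alpha> n)\<^sup>2" by simp
  qed
  then have "(\<lambda>n. sqrt ((\<alpha> n)\<^sup>2)) \<longlonglongrightarrow> sqrt 0" by (rule tendsto_real_sqrt)
  then show ?thesis by (simp add: tendsto_rabs_zero_iff)
qed

end

section \<open>Weights on an interval\<close>

locale interval_weight =
  fixes l L :: real and w :: "real \<Rightarrow> real"
  assumes l_less_L: "l < L"
    and measurable_w [measurable]: "w \<in> borel_measurable borel"
    and w_pos: "x \<in> {l..L} \<Longrightarrow> 0 < w x"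
    and w_outside: "x \<notin> {l..L} \<Longrightarrow> w x = 0"
    and integrable_w: "integrable lborel w"
begin

definition c :: real where "c = (l + L) / 2"
definition r :: real where "r = (L - l) / 2"

lemma r_pos: "r > 0" using l_less_L by (simp add: r_def)

definition circle_density :: "real \<Rightarrow> real" where
  "circle_density t = pi * r * sin t * w (c + r * cos t)"

lemma measurable_circle_density [measurable]: "circle_density \<in> borel_measurable borel"
  unfolding circle_density_def by measurable

lemma image_cosine: "(\<lambda>t. c + r * cos t) ` {0..pi} = {l..L}"
proof (intro equalityI subsetI)
  fix x assume "x \<in> (\<lambda>t. c + r * cos t) ` {0..pi}"
  then obtain t where "x = c + r * cos t" by auto
  moreover have "r * cos t \<le> r * 1" "r * (-1) \<le> r * cos t"
    using r_pos by (intro mult_left_mono; simp)+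
  ultimately show "x \<in> {l..L}" by (auto simp: c_def r_def field_simps)
next
  fix x assume x: "x \<in> {l..L}"
  define y where "y = (x - c) / r"
  have "-1 \<le> y" "y \<le> 1" using x r_pos by (auto simp: y_def c_def r_def field_simps)
  then have "x = c + r * cos (arccos y)" "arccos y \<in> {0..pi}"
    using r_pos by (auto simp: y_def arccos_lbound arccos_ubound)
  then show "x \<in> (\<lambda>t. c + r * cos t) ` {0..pi}" by blast
qed

text \<open>The substitution \<open>x = c + r cos t\<close>. The factor \<open>pi\<close> in the density on the circle compensates the
normalisation of the half circle to total mass \<open>1\<close>.\<close>

lemma transfer_to_half_circle:
  fixes F :: "real \<Rightarrow> real"
  assumes [measurable]: "F \<in> borel_measurable borel" and int: "integrable lborel (\<lambda>x. F x * w x)"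
  shows "integrable half_circle (\<lambda>t. F (c + r * cos t) * circle_density t)"
    "(\<integral>t. F (c + r * cos t) * circle_density t \<partial>half_circle) = (\<integral>x. F x * w x \<partial>lborel)"
proof -
  define f where "f = (\<lambda>x. F x * w x)"
  define h where "h = (\<lambda>t. \<bar>- r * sin t\<bar> * f (c + r * cos t))"
  have [measurable]: "f \<in> borel_measurable borel" "h \<in> borel_measurable borel"
    unfolding f_def h_def by measurable
  have f_ind: "indicator {l..L} x * f x = f x" for x
    using w_outside[of x] by (auto simp: f_def indicator_def)
  have "(\<lambda>x. indicator {l..L} x *\<^sub>R f x) = f" using f_ind by auto
  then have "set_integrable lebesgue {l..L} f" "(LINT x:{l..L}|lebesgue. f x) = (\<integral>x. f x \<partial>lborel)"
    using int by (simp_all add: set_integrable_def set_lebesgue_integral_def integrable_completion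
        integral_completion f_def[symmetric])
  then have "f absolutely_integrable_on (\<lambda>t. c + r * cos t) ` {0..pi} \<and>
      integral ((\<lambda>t. c + r * cos t) ` {0..pi}) f = (\<integral>x. f x \<partial>lborel)"
    unfolding image_cosine by (auto dest: set_lebesgue_integral_eq_integral(2))
  then have "h absolutely_integrable_on {0..pi} \<and> integral {0..pi} h = (\<integral>x. f x \<partial>lborel)"
    unfolding h_def
    by (subst has_absolute_integral_change_of_variables_1')
      (use r_pos in \<open>auto intro!: derivative_eq_intros inj_onI dest: cos_inj_pi\<close>)
  then have h: "set_integrable lebesgue {0..pi} h" "(LINT t:{0..pi}|lebesgue. h t) = (\<integral>x. f x \<partial>lborel)"
    using set_lebesgue_integral_eq_integral(2)[of "{0..pi}" h] by auto
  then have h: "set_integrable lborel {0..pi} h" "(LINT t:{0..pi}|lborel. h t) = (\<integral>x. f x \<partial>lborel)"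
    by (simp_all add: set_integrable_def set_lebesgue_integral_def integrable_completion
        integral_completion)
  have eq: "indicator {0..pi} t *\<^sub>R (F (c + r * cos t) * circle_density t) = pi * (indicator {0..pi} t *\<^sub>R h t)" for t
    using r_pos sin_ge_zero[of t]
    by (auto simp: indicator_def h_def f_def circle_density_def abs_mult)
  have "set_integrable lborel {0..pi} (\<lambda>t. F (c + r * cos t) * circle_density t)"
    using h(1) unfolding set_integrable_def eq by (rule integrable_mult_right)
  then show "integrable half_circle (\<lambda>t. F (c + r * cos t) * circle_density t)"
    by (subst integrable_half_circle_iff) auto
  have "(LINT t:{0..pi}|lborel. F (c + r * cos t) * circle_density t) = pi * (\<integral>x. f x \<partial>lborel)"
    using h(2) unfolding set_lebesgue_integral_def eq by simp
  then show "(\<integral>t. F (c + r * cos t) * circle_density t \<partial>half_circle) = (\<integral>x. F x * w x \<partial>lborel)"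
    by (subst integral_half_circle) (auto simp: f_def)
qed

sublocale circle_weight circle_density
proof
  show "integrable half_circle circle_density"
    using transfer_to_half_circle(1)[of "\<lambda>_. 1"] integrable_w by simp
  have "AE t in lborel. t \<noteq> 0 \<and> t \<noteq> pi"
    using AE_lborel_singleton[of 0] AE_lborel_singleton[of pi] by eventually_elim simp
  then have "AE t in lborel. t \<in> {0..pi} \<longrightarrow> 0 < circle_density t"
  proof eventually_elim
    case (elim t)
    show ?case
    proof
      assume t: "t \<in> {0..pi}"
      then have "c + r * cos t \<in> {l..L}" using image_cosine by blast
      moreover have "sin t > 0" using t elim by (intro sin_gt_zero) auto
      ultimately show "0 < circle_density t"
        using r_pos by (simp add: circle_density_def w_pos)
    qed
  qed
  then show "AE t in half_circle. 0 < circle_density t" by (simp add: AE_half_circle)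
qed

definition form :: "real poly \<Rightarrow> real poly \<Rightarrow> real" where
  "form p q = (\<integral>x. poly p x * poly q x * w x \<partial>lborel)"

lemma integrable_poly_w: "integrable lborel (\<lambda>x. poly p x * w x)"
proof -
  have "compact (poly p ` {l..L})"
    by (intro compact_continuous_image continuous_intros) auto
  have [measurable]: "poly p \<in> borel_measurable borel"
    by (intro borel_measurable_continuous_onI continuous_intros)
  from \<open>compact _\<close> obtain C where C: "\<forall>y\<in>poly p ` {l..L}. norm y \<le> C"
    using compact_imp_bounded bounded_iff by metis
  show ?thesis
  proof (rule Bochner_Integration.integrable_bound)
    show "integrable lborel (\<lambda>x. C * w x)" using integrable_w by simp
    have "\<bar>poly p x * w x\<bar> \<le> \<bar>C * w x\<bar>" for x
    proof (cases "x \<in> {l..L}")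
      case True
      then have "\<bar>poly p x\<bar> \<le> \<bar>C\<bar>" using C by force
      then show ?thesis by (auto simp: abs_mult intro!: mult_right_mono)
    qed (simp add: w_outside)
    then show "AE x in lborel. norm (poly p x * w x) \<le> norm (C * w x)" by simp
  qed measurable
qed

lemma integrable_form: "integrable lborel (\<lambda>x. poly p x * poly q x * w x)"
  using integrable_poly_w[of "p * q"] by simp

lemma form_commute: "form p q = form q p"
  by (simp add: form_def mult.commute)

lemma form_add_right: "form p (q + q') = form p q + form p q'"
  using integrable_form by (simp add: form_def algebra_simps)

lemma form_smult_right: "form p (smult a q) = a * form p q"
  unfolding form_def by (subst Bochner_Integration.integral_mult_right_zero[symmetric]) (simp add: mult_ac)

lemma form_diff_right: "form p (q - q') = form p q - form p q'"
  using form_add_right[of p q "smult (-1) q'"] form_smult_right[of p "-1" q'] by simp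

lemma form_0_right [simp]: "form p 0 = 0"
  by (simp add: form_def)

lemma form_half_circle:
  "form p q = (\<integral>t. poly p (c + r * cos t) * poly q (c + r * cos t) * circle_density t \<partial>half_circle)"
  "integrable half_circle (\<lambda>t. poly p (c + r * cos t) * poly q (c + r * cos t) * circle_density t)"
  using transfer_to_half_circle[of "\<lambda>x. poly p x * poly q x"] integrable_form[of p q]
  by (simp_all add: form_def borel_measurable_continuous_onI continuous_intros)

lemma form_self_eq_0:
  assumes "form p p = 0"
  shows "p = 0"
proof (rule ccontr)
  assume "p \<noteq> 0"
  have "AE x in lborel. poly p x * poly p x * w x = 0"
  proof (subst integral_nonneg_eq_0_iff_AE[symmetric])
    show "(\<integral>x. poly p x * poly p x * w x \<partial>lborel) = 0" using assms by (simp add: form_def)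
    have "0 \<le> w x" for x using w_pos[of x] w_outside[of x] by (cases "x \<in> {l..L}") auto
    then show "AE x in lborel. 0 \<le> poly p x * poly p x * w x" by simp
  qed (rule integrable_form)
  moreover have "AE x in lborel. poly p x \<noteq> 0"
    by (rule AE_I'[OF finite_imp_null_set_lborel[OF poly_roots_finite[OF \<open>p \<noteq> 0\<close>]]]) auto
  ultimately have "AE x in lborel. x \<notin> {l..L}"
  proof eventually_elim
    case (elim x)
    then show ?case using w_pos[of x] by auto
  qed
  then have "emeasure lborel {l..L} = 0"
    by (subst (asm) AE_iff_measurable[of "{l..L}"]) auto
  then show False using l_less_L by simp
qed

text \<open>Chebyshev polynomials of the first kind, transplanted from \<open>[-1, 1]\<close> to \<open>[l, L]\<close>.\<close>

fun chebyshev :: "nat \<Rightarrow> real poly" where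
  "chebyshev 0 = 1"
| "chebyshev (Suc 0) = [:- c / r, 1 / r:]"
| "chebyshev (Suc (Suc k)) = smult 2 (chebyshev (Suc 0) * chebyshev (Suc k)) - chebyshev k"

lemma chebyshev_joukowski:
  fixes z :: real
  assumes "z \<noteq> 0"
  shows "poly (chebyshev k) (c + r * (z + 1 / z) / 2) = (z ^ k + 1 / z ^ k) / 2"
proof (induction k rule: chebyshev.induct)
  case (3 k)
  let ?x = "c + r * (z + 1 / z) / 2"
  have "poly (chebyshev (Suc 0)) ?x = (z + 1 / z) / 2"
    using r_pos by (simp add: field_simps)
  then have "poly (chebyshev (Suc (Suc k))) ?x =
      2 * ((z + 1 / z) / 2 * ((z ^ Suc k + 1 / z ^ Suc k) / 2)) - (z ^ k + 1 / z ^ k) / 2"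
    unfolding chebyshev.simps(3) using 3
    by (simp only: poly_diff poly_smult poly_mult)
  also have "\<dots> = (z ^ Suc (Suc k) + 1 / z ^ Suc (Suc k)) / 2"
    using assms by (simp add: field_simps)
  finally show ?case .
qed (use r_pos in \<open>auto simp: field_simps\<close>)

lemma chebyshev_cos: "poly (chebyshev k) (c + r * cos t) = cos (real k * t)"
proof (induction k rule: chebyshev.induct)
  case (3 k)
  have "cos (real (Suc (Suc k)) * t) + cos (real k * t) = 2 * (cos t * cos (real (Suc k) * t))"
  proof -
    have a: "real (Suc (Suc k)) * t = real (Suc k) * t + t" "real k * t = real (Suc k) * t - t"
      by (simp_all add: algebra_simps)
    have "cos (y + t) + cos (y - t) = 2 * (cos t * cos y)" for y
      by (simp add: cos_add cos_diff)
    then show ?thesis by (simp only: a)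
  qed
  moreover have "poly (chebyshev (Suc 0)) (c + r * cos t) = cos t"
    using r_pos by (simp add: field_simps)
  ultimately show ?case using 3 by (simp add: algebra_simps del: chebyshev.simps(2) of_nat_Suc)
qed (use r_pos in \<open>auto simp: field_simps\<close>)

lemma degree_chebyshev: "degree (chebyshev k) \<le> k"
proof (induction k rule: chebyshev.induct)
  case (3 k)
  have "degree (chebyshev (Suc 0) * chebyshev (Suc k)) \<le> Suc (Suc k)"
    by (rule order.trans[OF degree_mult_le]) (use 3 r_pos in simp)
  then show ?case using 3
    by (auto intro!: degree_diff_le order.trans[OF degree_smult_le] simp del: chebyshev.simps(2))
qed (use r_pos in auto)

lemma coeff_chebyshev: "coeff (chebyshev (Suc k)) (Suc k) = 2 ^ k / r ^ Suc k"
proof (induction k)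
  case (Suc k)
  have "coeff (chebyshev (Suc k)) (Suc (Suc k)) = 0" "coeff (chebyshev k) (Suc (Suc k)) = 0"
    using degree_chebyshev[of k] degree_chebyshev[of "Suc k"] by (simp_all add: coeff_eq_0)
  then show ?case using Suc by simp
qed simp

end

section \<open>Orthogonal polynomials on the interval\<close>

lemma poly_Psi_reversed:
  fixes z :: real
  assumes "z \<noteq> 0"
  shows "poly (Psi W n) z = z ^ n * poly (Phi W n) (1 / z)"
  using assms
proof (induction n arbitrary: z)
  case (Suc n)
  have "poly (Psi W n) (1 / z) = (1 / z) ^ n * poly (Phi W n) z"
    using Suc.IH[of "1 / z"] Suc.prems by simp
  with Suc.IH[OF Suc.prems] Suc.prems show ?case
    by (simp add: Phi_Suc Psi_Suc power_divide field_simps del: smult_pCons)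
qed simp

lemma coeff_Phi_0: "coeff (Phi W (Suc n)) 0 = - verblunsky W n"
  using Phi_Psi_degree[of W n] by (simp add: Phi_Suc)

lemma coeff_Psi_last: "coeff (Psi W (Suc n)) (Suc n) = - verblunsky W n"
  using Phi_Psi_degree[of W n] by (simp add: Psi_Suc coeff_eq_0)

lemma (in circle_weight) form_Phi_Psi: "B (\<Phi> (Suc n)) (\<Psi> (Suc n)) = - \<alpha> n * E (Suc n)"
proof -
  have "B (\<Phi> (Suc n)) (\<Psi> (Suc n)) = (\<Sum>j\<le>Suc n. coeff (\<Psi> (Suc n)) j * B (\<Phi> (Suc n)) (monom 1 j))"
    unfolding circle_form_sum_right[OF integrable_weight, of _ "\<Psi> (Suc n)"]
    using Phi_Psi_degree[of W "Suc n"] by (intro sum.mono_neutral_left) (auto simp: coeff_eq_0)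
  also have "\<dots> = (\<Sum>j\<in>{Suc n}. coeff (\<Psi> (Suc n)) j * B (\<Phi> (Suc n)) (monom 1 j))"
    by (rule sum.mono_neutral_right) (auto simp: Phi_orthogonal)
  finally show ?thesis by (simp add: coeff_Psi_last B_Phi_monom)
qed

context interval_weight
begin

text \<open>The polynomials \<open>b k\<close> with \<open>k < n\<close> span all polynomials of degree below \<open>n\<close>, since each has exact degree \<open>k\<close>.\<close>

lemma form_eq_0_if_basis:
  assumes "\<And>k. k < n \<Longrightarrow> degree (b k) \<le> k" "\<And>k. k < n \<Longrightarrow> coeff (b k) k \<noteq> 0"
    and orth: "\<And>k. k < n \<Longrightarrow> form q (b k) = 0"
    and "\<And>i. n \<le> i \<Longrightarrow> coeff p i = 0"
  shows "form q p = 0"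
proof -
  have "form q p = 0" if "m \<le> n" "\<forall>i\<ge>m. coeff p i = 0" for m p
    using that
  proof (induction m arbitrary: p)
    case 0
    then have "p = 0" by (intro poly_eqI) simp
    then show ?case by simp
  next
    case (Suc m)
    define s where "s = coeff p m / coeff (b m) m"
    have "coeff (p - smult s (b m)) i = 0" if "i \<ge> m" for i
    proof (cases "i = m")
      case True
      then show ?thesis using assms(2)[of m] Suc.prems by (simp add: s_def)
    next
      case False
      then show ?thesis using that Suc.prems assms(1)[of m] by (simp add: coeff_eq_0)
    qed
    then have "form q (p - smult s (b m)) = 0" using Suc by simp
    then show ?case using orth[of m] Suc.prems by (simp add: form_diff_right form_smult_right)
  qed
  then show ?thesis using assms(4) by blast
qed

text \<open>On the circle \<open>(\<Phi> (2 n) z + \<Psi> (2 n) z) / z^n\<close> is twice the real part of \<open>\<Phi> (2 n) z / z^n\<close>, hence a cosine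
sum with frequencies \<open>|j - n|\<close>, hence a polynomial in \<open>x = c + r cos t\<close>. The truncated differences
\<open>(j - n) + (n - j)\<close> express \<open>|j - n|\<close> in the natural numbers.\<close>

definition orthopoly :: "nat \<Rightarrow> real poly" where
  "orthopoly n = (\<Sum>j\<le>2 * n. smult (2 * coeff (\<Phi> (2 * n)) j) (chebyshev ((j - n) + (n - j))))"

lemma orthopoly_cos:
  "poly (orthopoly n) (c + r * cos t) = 2 * Re (cpoly (\<Phi> (2 * n)) (cis t) * cnj (cis t ^ n))"
proof -
  have "Re (of_real a * cis t ^ j * cnj (cis t ^ n)) = a * cos (real ((j - n) + (n - j)) * t)" for a j
  proof -
    have "cis t ^ j * cnj (cis t ^ n) = cis (real j * t - real n * t)"
      by (simp add: Complex.DeMoivre cis_cnj cis_mult)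
    then have eq: "of_real a * cis t ^ j * cnj (cis t ^ n) = of_real a * cis (real j * t - real n * t)"
      by (simp only: mult.assoc)
    have "Re (of_real a * cis t ^ j * cnj (cis t ^ n)) = a * cos (real j * t - real n * t)"
      unfolding eq by simp
    moreover have "cos (real j * t - real n * t) = cos (real ((j - n) + (n - j)) * t)"
    proof (cases "n \<le> j")
      case True
      then show ?thesis by (simp add: of_nat_diff algebra_simps)
    next
      case False
      then have "real ((j - n) + (n - j)) * t = - (real j * t - real n * t)"
        by (simp add: of_nat_diff algebra_simps)
      then show ?thesis by (simp only: cos_minus)
    qed
    ultimately show ?thesis by simp
  qed
  note cos_term = this
  have "2 * Re (cpoly (\<Phi> (2 * n)) (cis t) * cnj (cis t ^ n)) =
      2 * (\<Sum>j\<le>2 * n. Re (of_real (coeff (\<Phi> (2 * n)) j) * cis t ^ j * cnj (cis t ^ n)))"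
    by (simp only: cpoly_altdef degree_Phi sum_distrib_right Re_sum)
  also have "\<dots> = (\<Sum>j\<le>2 * n. 2 * coeff (\<Phi> (2 * n)) j * cos (real ((j - n) + (n - j)) * t))"
    unfolding cos_term by (simp only: sum_distrib_left mult.assoc)
  finally show ?thesis by (simp only: orthopoly_def poly_sum poly_smult chebyshev_cos)
qed

lemma orthopoly_joukowski:
  fixes z :: real
  assumes "z \<noteq> 0"
  shows "poly (orthopoly n) (c + r * (z + 1 / z) / 2) =
    (poly (\<Phi> (2 * n)) z + poly (\<Psi> (2 * n)) z) / z ^ n"
proof -
  have pow: "(z ^ ((j - n) + (n - j)) + 1 / z ^ ((j - n) + (n - j))) * z ^ n = z ^ j + (z ^ n * z ^ n) * (1 / z) ^ j"
    if "j \<le> 2 * n" for j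
  proof (cases "n \<le> j")
    case True
    then obtain d where "j = n + d" using le_Suc_ex by blast
    then show ?thesis using assms by (simp add: power_add power_divide field_simps)
  next
    case False
    then obtain d where "n = j + d" using le_Suc_ex nat_le_linear by metis
    then show ?thesis using assms by (simp add: power_add power_divide field_simps)
  qed
  have "poly (orthopoly n) (c + r * (z + 1 / z) / 2) * z ^ n =
      (\<Sum>j\<le>2 * n. coeff (\<Phi> (2 * n)) j * ((z ^ ((j - n) + (n - j)) + 1 / z ^ ((j - n) + (n - j))) * z ^ n))"
    using assms by (simp add: orthopoly_def poly_sum chebyshev_joukowski sum_distrib_left mult_ac)
  also have "\<dots> = (\<Sum>j\<le>2 * n. coeff (\<Phi> (2 * n)) j * (z ^ j + z ^ (2 * n) * (1 / z) ^ j))"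
    by (intro sum.cong refl) (simp only: pow[folded power_add mult_2] atMost_iff)
  also have "\<dots> = poly (\<Phi> (2 * n)) z + z ^ (2 * n) * poly (\<Phi> (2 * n)) (1 / z)"
    by (simp add: poly_altdef degree_Phi distrib_left sum.distrib sum_distrib_left mult_ac)
  also have "z ^ (2 * n) * poly (\<Phi> (2 * n)) (1 / z) = poly (\<Psi> (2 * n)) z"
    by (rule poly_Psi_reversed[OF assms, symmetric])
  finally show ?thesis using assms by (simp add: field_simps)
qed

lemma degree_orthopoly: "degree (orthopoly n) \<le> n"
  unfolding orthopoly_def
  by (intro degree_sum_le order.trans[OF degree_smult_le] order.trans[OF degree_chebyshev]) auto

text \<open>Only the frequency \<open>Suc n\<close> contributes, and it comes from the lowest and the highest coefficient of
\<open>\<Phi> (2 * Suc n)\<close>.\<close>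

lemma coeff_orthopoly:
  "coeff (orthopoly (Suc n)) (Suc n) = (1 - \<alpha> (2 * n + 1)) * (2 / r) ^ Suc n"
proof -
  let ?N = "2 * Suc n"
  let ?t = "\<lambda>j. 2 * coeff (\<Phi> ?N) j * coeff (chebyshev ((j - Suc n) + (Suc n - j))) (Suc n)"
  have "coeff (orthopoly (Suc n)) (Suc n) = (\<Sum>j\<le>?N. ?t j)"
    by (simp only: orthopoly_def coeff_sum coeff_smult)
  also have "\<dots> = (\<Sum>j\<in>{0, ?N}. ?t j)"
  proof (rule sum.mono_neutral_right)
    show "\<forall>j\<in>{..?N} - {0, ?N}. ?t j = 0"
    proof
      fix j assume "j \<in> {..?N} - {0, ?N}"
      then have "(j - Suc n) + (Suc n - j) < Suc n" by auto
      then have "coeff (chebyshev ((j - Suc n) + (Suc n - j))) (Suc n) = 0"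
        by (intro coeff_eq_0 le_less_trans[OF degree_chebyshev])
      then show "?t j = 0" by simp
    qed
  qed auto
  also have "\<dots> = 2 * (coeff (\<Phi> ?N) 0 + coeff (\<Phi> ?N) ?N) * coeff (chebyshev (Suc n)) (Suc n)"
    by (simp add: algebra_simps)
  also have "coeff (\<Phi> ?N) ?N = 1" using Phi_Psi_degree by blast
  also have "coeff (\<Phi> ?N) 0 = - \<alpha> (2 * n + 1)" using coeff_Phi_0[of _ "2 * n + 1"] by simp
  finally show ?thesis unfolding coeff_chebyshev by (simp add: power_divide)
qed

text \<open>Multiplication by \<open>cos (k t)\<close> shifts \<open>z^n\<close> to \<open>z^(n + k)\<close> and \<open>z^(n - k)\<close>, and \<open>\<Phi> (2 n)\<close> is orthogonal to both
powers.\<close>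

lemma form_orthopoly_chebyshev:
  assumes "k < n"
  shows "form (orthopoly n) (chebyshev k) = 0"
proof -
  let ?P = "\<lambda>t. cpoly (\<Phi> (2 * n)) (cis t)"
  have "2 * Re (P * cnj (z ^ n)) * cos (real k * t) = Re (P * cnj (z ^ (n + k))) + Re (P * cnj (z ^ (n - k)))"
    if "z = cis t" for P z t
  proof -
    have zz: "z ^ k * cnj (z ^ k) = 1"
      using complex_norm_square[of "z ^ k"] that by (simp add: norm_power)
    have "z ^ k = cis (real k * t)" by (simp add: that Complex.DeMoivre)
    then have "of_real (2 * cos (real k * t)) = z ^ k + cnj (z ^ k)"
      by (simp only:) (simp add: complex_eq_iff)
    then have "P * cnj (z ^ n) * of_real (2 * cos (real k * t)) =
        P * (cnj (z ^ n) * cnj (z ^ k)) + P * (cnj (z ^ n) * z ^ k)"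
      by (simp only:) (simp add: algebra_simps)
    also have "cnj (z ^ n) * cnj (z ^ k) = cnj (z ^ (n + k))" by (simp add: power_add)
    also have "cnj (z ^ n) * z ^ k = cnj (z ^ (n - k))"
    proof -
      have "z ^ n = z ^ (n - k) * z ^ k" using assms by (simp flip: power_add)
      then have "cnj (z ^ n) * z ^ k = cnj (z ^ (n - k)) * (z ^ k * cnj (z ^ k))" by simp
      then show ?thesis unfolding zz by simp
    qed
    finally have "P * cnj (z ^ n) * of_real (2 * cos (real k * t)) = P * cnj (z ^ (n + k)) + P * cnj (z ^ (n - k))" .
    from arg_cong[OF this, of Re] show ?thesis by (simp add: algebra_simps)
  qed
  then have eq: "poly (orthopoly n) (c + r * cos t) * poly (chebyshev k) (c + r * cos t) =
      Re (?P t * cnj (cis t ^ (n + k))) + Re (?P t * cnj (cis t ^ (n - k)))" for t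
    by (simp only: orthopoly_cos chebyshev_cos)
  have "form (orthopoly n) (chebyshev k) = B (\<Phi> (2 * n)) (monom 1 (n + k)) + B (\<Phi> (2 * n)) (monom 1 (n - k))"
    unfolding form_half_circle eq circle_form_def cpoly_monom of_real_1 mult_1 distrib_right
    by (rule Bochner_Integration.integral_add)
      (use integrable_circle_form[OF integrable_weight, of "\<Phi> (2 * n)" "monom 1 _"] in
        \<open>simp_all only: cpoly_monom of_real_1 mult_1\<close>)
  then show ?thesis using assms by (simp add: Phi_orthogonal)
qed

lemma form_orthopoly_self:
  "form (orthopoly (Suc n)) (orthopoly (Suc n)) = 2 * (1 - \<alpha> (2 * n + 1)) * E (2 * n + 2)"
proof -
  let ?N = "2 * Suc n"
  let ?P = "\<lambda>t. cpoly (\<Phi> ?N) (cis t)" and ?Q = "\<lambda>t. cpoly (\<Psi> ?N) (cis t)"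
  have eq: "poly (orthopoly (Suc n)) (c + r * cos t) * poly (orthopoly (Suc n)) (c + r * cos t) =
      2 * (Re (?P t * cnj (?P t)) + Re (?P t * cnj (?Q t)))" for t
  proof -
    define X where "X = ?P t * cnj (cis t ^ Suc n)"
    have "norm X = norm (?P t)" by (simp add: X_def norm_mult norm_power)
    then have "Re (?P t * cnj (?P t)) = (norm X)\<^sup>2"
      by (simp only: cmod_power2) (simp add: power2_eq_square)
    moreover have "?P t * cnj (?Q t) = X\<^sup>2"
      using Psi_on_circle[of "cis t" _ ?N] by (simp add: X_def power_mult_distrib power2_eq_square mult_2 power_add)
    moreover have "(2 * Re X) * (2 * Re X) = 2 * ((norm X)\<^sup>2 + Re (X\<^sup>2))"
      unfolding cmod_power2 by (simp add: power2_eq_square)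
    ultimately show ?thesis by (simp only: orthopoly_cos X_def)
  qed
  have "form (orthopoly (Suc n)) (orthopoly (Suc n)) = 2 * (B (\<Phi> ?N) (\<Phi> ?N) + B (\<Phi> ?N) (\<Psi> ?N))"
    unfolding form_half_circle eq circle_form_def mult.assoc distrib_right
    by (subst Bochner_Integration.integral_mult_right_zero, subst Bochner_Integration.integral_add)
      (intro integrable_circle_form[OF integrable_weight] refl)+
  then show ?thesis
    using form_Phi_Psi[of "2 * n + 1"] by (simp add: E_def algebra_simps)
qed

end

section \<open>Ratio asymptotics outside the disc\<close>

lemma perturbed_contraction_tendsto_0:
  fixes x e :: "nat \<Rightarrow> real"
  assumes nonneg: "\<And>n. 0 \<le> x n" and step: "\<And>n. x (Suc n) \<le> q * x n + e n"
    and q: "0 \<le> q" "q < 1" and e: "e \<longlonglongrightarrow> 0"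
  shows "x \<longlonglongrightarrow> 0"
proof (rule order_tendstoI)
  fix d :: real assume "d > 0"
  then have "0 < (1 - q) * (d / 2)" using q by simp
  from order_tendstoD(2)[OF e this] obtain N where N: "e n < (1 - q) * (d / 2)" if "n \<ge> N" for n
    unfolding eventually_sequentially by blast
  have bound: "x (k + N) \<le> q ^ k * x N + d / 2" for k
  proof (induction k)
    case (Suc k)
    have "q * x (k + N) \<le> q * (q ^ k * x N + d / 2)"
      using Suc q by (intro mult_left_mono)
    then have "x (Suc k + N) \<le> q * (q ^ k * x N + d / 2) + (1 - q) * (d / 2)"
      using step[of "k + N"] N[of "k + N"] by simp
    also have "\<dots> = q ^ Suc k * x N + d / 2" by (simp add: field_simps)
    finally show ?case .
  qed (use \<open>d > 0\<close> in simp)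
  have "(\<lambda>k. q ^ k * x N) \<longlonglongrightarrow> 0"
    using q by (intro tendsto_mult_left_zero LIMSEQ_power_zero) simp
  then have "\<forall>\<^sub>F k in sequentially. q ^ k * x N < d / 2"
    by (rule order_tendstoD) (use \<open>d > 0\<close> in simp)
  then have "\<forall>\<^sub>F k in sequentially. x (k + N) < d"
  proof eventually_elim
    case (elim k)
    then show ?case using bound[of k] by linarith
  qed
  then show "\<forall>\<^sub>F n in sequentially. x n < d"
    by (subst (asm) eventually_sequentially_seg)
next
  fix d :: real assume "d < 0"
  then have "d < x n" for n using nonneg[of n] by simp
  then show "\<forall>\<^sub>F n in sequentially. d < x n" by simp
qed

context circle_weight
begin

text \<open>The quotient \<open>R n = \<Psi> n / \<Phi> n\<close> satisfies \<open>R (n + 1) = (R n - \<alpha> n z) / (z - \<alpha> n R n)\<close>: up to an error of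
order \<open>\<alpha> n\<close>, each step divides by \<open>z\<close>.\<close>

lemma Psi_over_Phi_tendsto_0:
  fixes z :: real
  assumes "\<bar>z\<bar> > 1"
  shows "(\<lambda>n. poly (\<Psi> n) z / poly (\<Phi> n) z) \<longlonglongrightarrow> 0"
proof -
  define R where "R = (\<lambda>n. poly (\<Psi> n) z / poly (\<Phi> n) z)"
  have nz: "poly (\<Phi> n) z \<noteq> 0" for n
    using Phi_outside_disc(2)[of "of_real z" n] assms by (simp add: cpoly_of_real)
  have R1: "\<bar>R n\<bar> \<le> 1" for n
    using Phi_outside_disc(1)[of "of_real z" n] assms nz[of n] by (simp add: cpoly_of_real R_def)
  have "\<bar>R (Suc n)\<bar> \<le> 1 / \<bar>z\<bar> * \<bar>R n\<bar> + 2 * \<bar>\<alpha> n\<bar>" for n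
  proof -
    have P: "poly (\<Psi> k) z = R k * poly (\<Phi> k) z" for k
      using nz[of k] by (simp add: R_def)
    have "(R n - \<alpha> n * z) * poly (\<Phi> n) z = R (Suc n) * (z - \<alpha> n * R n) * poly (\<Phi> n) z"
      using P[of "Suc n"] P[of n] by (simp add: Phi_Suc Psi_Suc algebra_simps)
    then have "R n - \<alpha> n * z = R (Suc n) * (z - \<alpha> n * R n)"
      using nz[of n] by (simp only: mult_cancel_right) simp
    then have "R (Suc n) * z = R n - \<alpha> n * z + \<alpha> n * (R n * R (Suc n))"
      by (simp add: algebra_simps)
    then have "\<bar>R (Suc n)\<bar> * \<bar>z\<bar> = \<bar>R n - \<alpha> n * z + \<alpha> n * (R n * R (Suc n))\<bar>"
      by (metis abs_mult)
    also have "\<dots> \<le> \<bar>R n\<bar> + \<bar>\<alpha> n\<bar> * \<bar>z\<bar> + \<bar>\<alpha> n\<bar> * (\<bar>R n\<bar> * \<bar>R (Suc n)\<bar>)"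
      unfolding abs_mult[symmetric] by linarith
    also have "\<bar>\<alpha> n\<bar> * (\<bar>R n\<bar> * \<bar>R (Suc n)\<bar>) \<le> \<bar>\<alpha> n\<bar> * (1 * 1)"
      using R1 by (intro mult_left_mono mult_mono) auto
    also have "\<bar>\<alpha> n\<bar> * (1 * 1) \<le> \<bar>\<alpha> n\<bar> * \<bar>z\<bar>"
      using assms by (intro mult_left_mono) auto
    finally show ?thesis using assms by (simp add: field_simps)
  qed
  then have "(\<lambda>n. \<bar>R n\<bar>) \<longlonglongrightarrow> 0"
    by (rule perturbed_contraction_tendsto_0[rotated])
      (use assms verblunsky_tendsto_0 in \<open>auto intro!: tendsto_mult_right_zero tendsto_rabs_zero\<close>)
  then have "R \<longlonglongrightarrow> 0" by (simp only: tendsto_rabs_zero_iff)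
  then show ?thesis by (simp add: R_def)
qed

lemma Phi_ratio_tendsto:
  fixes z :: real
  assumes "\<bar>z\<bar> > 1"
  shows "(\<lambda>n. poly (\<Phi> (Suc n)) z / poly (\<Phi> n) z) \<longlonglongrightarrow> z"
proof -
  have nz: "poly (\<Phi> n) z \<noteq> 0" for n
    using Phi_outside_disc(2)[of "of_real z" n] assms by (simp add: cpoly_of_real)
  have "(\<lambda>n. z - \<alpha> n * (poly (\<Psi> n) z / poly (\<Phi> n) z)) \<longlonglongrightarrow> z - 0 * 0"
    by (intro tendsto_intros verblunsky_tendsto_0 Psi_over_Phi_tendsto_0 assms)
  also have "(\<lambda>n. z - \<alpha> n * (poly (\<Psi> n) z / poly (\<Phi> n) z)) =
      (\<lambda>n. poly (\<Phi> (Suc n)) z / poly (\<Phi> n) z)"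
    using nz by (simp add: Phi_Suc field_simps)
  finally show ?thesis by simp
qed

lemma E_ratio_tendsto: "(\<lambda>n. E (Suc n) / E n) \<longlonglongrightarrow> 1"
proof -
  have "(\<lambda>n. 1 - (\<alpha> n)\<^sup>2) \<longlonglongrightarrow> 1 - 0\<^sup>2"
    by (intro tendsto_intros verblunsky_tendsto_0)
  also have "(\<lambda>n. 1 - (\<alpha> n)\<^sup>2) = (\<lambda>n. E (Suc n) / E n)"
    using E_pos by (auto simp: E_Suc fun_eq_iff less_imp_neq[symmetric])
  finally show ?thesis by simp
qed

end

context interval_weight
begin

text \<open>By \<open>orthopoly_joukowski\<close> the value at \<open>x\<close> is \<open>\<Phi> (2 n) z (1 + R (2 n)) / z^n\<close>; two steps of the circle
recursion contribute \<open>z^2\<close> and the denominator takes back one factor \<open>z\<close>.\<close>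

lemma orthopoly_ratio_tendsto:
  fixes z :: real
  assumes z: "\<bar>z\<bar> > 1"
  defines "x \<equiv> c + r * (z + 1 / z) / 2"
  shows "(\<lambda>n. poly (orthopoly (Suc n)) x / poly (orthopoly n) x) \<longlonglongrightarrow> z"
proof -
  define f where "f = (\<lambda>n. poly (\<Phi> n) z)"
  define R where "R = (\<lambda>n. poly (\<Psi> n) z / poly (\<Phi> n) z)"
  have nz: "f n \<noteq> 0" for n
    using Phi_outside_disc(2)[of "of_real z" n] z by (simp add: cpoly_of_real f_def)
  have ev: "filterlim (\<lambda>n. 2 * n + k) sequentially sequentially" for k :: nat
    by (rule filterlim_subseq) (auto simp: strict_mono_def)
  have R: "(\<lambda>n. R (2 * n + k)) \<longlonglongrightarrow> 0" for k
    using filterlim_compose[OF Psi_over_Phi_tendsto_0[OF z] ev] by (simp add: R_def)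
  have f: "(\<lambda>n. f (Suc (2 * n + k)) / f (2 * n + k)) \<longlonglongrightarrow> z" for k
    using filterlim_compose[OF Phi_ratio_tendsto[OF z] ev] by (simp add: f_def)
  have val: "poly (orthopoly n) x = f (2 * n) * (1 + R (2 * n)) / z ^ n" for n
  proof -
    have "poly (\<Phi> (2 * n)) z + poly (\<Psi> (2 * n)) z = f (2 * n) * (1 + R (2 * n))"
      using nz[of "2 * n"] by (simp add: f_def R_def field_simps)
    then show ?thesis using orthopoly_joukowski[of z n] z by (auto simp: x_def)
  qed
  have "(\<lambda>n. f (Suc (2 * n + 1)) / f (2 * n + 1) * (f (Suc (2 * n + 0)) / f (2 * n + 0))
      * ((1 + R (2 * n + 2)) / (1 + R (2 * n + 0))) / z) \<longlonglongrightarrow> z * z * ((1 + 0) / (1 + 0)) / z"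
    using z by (intro tendsto_intros f R) auto
  also have "(\<lambda>n. f (Suc (2 * n + 1)) / f (2 * n + 1) * (f (Suc (2 * n + 0)) / f (2 * n + 0))
      * ((1 + R (2 * n + 2)) / (1 + R (2 * n + 0))) / z) =
      (\<lambda>n. poly (orthopoly (Suc n)) x / poly (orthopoly n) x)"
  proof
    fix n
    show "f (Suc (2 * n + 1)) / f (2 * n + 1) * (f (Suc (2 * n + 0)) / f (2 * n + 0))
      * ((1 + R (2 * n + 2)) / (1 + R (2 * n + 0))) / z =
      poly (orthopoly (Suc n)) x / poly (orthopoly n) x"
      using z nz[of "2 * n"] nz[of "Suc (2 * n)"] by (simp add: val divide_simps)
  qed
  finally show ?thesis using z by simp
qed

lemma form_pCons_swap: "form p (pCons 0 q) = form q (pCons 0 p)"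
  by (simp add: form_def mult_ac)

text \<open>Orthogonal polynomials are unique up to a scalar: after matching the leading coefficients the difference
has lower degree and is orthogonal to itself.\<close>

lemma orthogonal_eq_smult_orthopoly:
  assumes "degree p = Suc n" and orth: "\<And>q. degree q < Suc n \<Longrightarrow> form p q = 0"
  shows "p = smult (coeff p (Suc n) / coeff (orthopoly (Suc n)) (Suc n)) (orthopoly (Suc n))"
proof -
  let ?q = "orthopoly (Suc n)"
  define s where "s = coeff p (Suc n) / coeff ?q (Suc n)"
  define D where "D = p - smult s ?q"
  have "coeff ?q (Suc n) \<noteq> 0"
    using abs_verblunsky_less_1[of "2 * n + 1"] r_pos by (simp add: coeff_orthopoly)
  then have "coeff D (Suc n) = 0" by (simp add: D_def s_def)
  moreover have "degree D \<le> Suc n"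
    unfolding D_def using assms(1) degree_orthopoly[of "Suc n"]
    by (intro degree_diff_le order.trans[OF degree_smult_le]) auto
  ultimately have D: "coeff D i = 0" if "i \<ge> Suc n" for i
    using that by (cases "i = Suc n") (auto simp: coeff_eq_0)
  have "form ?q D = 0"
  proof (rule form_eq_0_if_basis[where n = "Suc n" and b = chebyshev])
    show "coeff (chebyshev k) k \<noteq> 0" for k
      using coeff_chebyshev r_pos by (cases k) auto
  qed (use degree_chebyshev form_orthopoly_chebyshev D in auto)
  moreover have "form p D = 0"
  proof (cases "D = 0")
    case False
    then have "degree D < Suc n" using D leading_coeff_0_iff not_less by blast
    then show ?thesis by (rule orth)
  qed simp
  ultimately have "form D D = 0"
    by (subst (2) D_def) (simp add: form_diff_right form_smult_right form_commute[of D])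
  then have "D = 0" by (rule form_self_eq_0)
  then show ?thesis by (simp add: D_def s_def)
qed

text \<open>Comparing leading coefficients in the recurrence gives \<open>b t\<close> as a quotient of consecutive leading
coefficients. Pairing the recurrence with \<open>P (t - 2)\<close> gives
\<open>a t - 1 = (b t / b (t - 1)) * (N (t - 1) / N (t - 2))\<close> with the square norms \<open>N\<close>. Both are explicit in terms of
\<open>x n\<close>, the value at \<open>0\<close> of the orthogonal polynomial coming from the circle, and of \<open>\<alpha>\<close>; the factors in \<open>\<alpha>\<close>
tend to \<open>1\<close> and \<open>x (n + 1) / x n\<close> tends to \<open>z\<close>.\<close>

lemma recurrence_coefficients_tendsto:
  assumes z: "\<bar>z\<bar> > 1" "c + r * (z + 1 / z) / 2 = 0"
    and degree_P: "\<And>n. degree (P n) = n"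
    and orth: "\<And>i j. i \<noteq> j \<Longrightarrow> form (P i) (P j) = 0"
    and residual: "\<And>n. poly (P n) 0 = 1"
    and rec: "three_term_recurrence P a b"
  shows "(\<lambda>t. a t - 1) \<longlonglongrightarrow> 1 / z\<^sup>2" "b \<longlonglongrightarrow> 2 / (r * z)"
proof -
  have coeff_P: "coeff (P n) n \<noteq> 0" for n
    using degree_P[of n] residual[of n] by (metis leading_coeff_0_iff poly_0 zero_neq_one)
  have orth': "form (P n) q = 0" if "degree q < n" for n q
  proof (rule form_eq_0_if_basis[where n = n and b = P])
    show "form (P n) (P k) = 0" if "k < n" for k
      using orth[of n k] that by simp
    show "coeff q i = 0" if "n \<le> i" for i
      using \<open>degree q < n\<close> that by (intro coeff_eq_0) simp
  qed (simp_all add: degree_P coeff_P)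
  define x where "x = (\<lambda>n. poly (orthopoly n) 0)"
  define y where "y = (\<lambda>n. 1 - \<alpha> (2 * n + 1))"
  have y_pos: "y n > 0" for n
    using abs_verblunsky_less_1[of "2 * n + 1"] by (simp add: y_def)
  define \<kappa> where "\<kappa> = (\<lambda>n. coeff (P n) n / coeff (orthopoly n) n)"
  have P_eq: "P (Suc n) = smult (\<kappa> (Suc n)) (orthopoly (Suc n))" for n
    unfolding \<kappa>_def by (rule orthogonal_eq_smult_orthopoly) (auto simp: degree_P orth')
  have kx: "\<kappa> (Suc n) * x (Suc n) = 1" for n
    using residual[of "Suc n"] by (simp add: P_eq x_def)
  then have x_nz: "x (Suc n) \<noteq> 0" for n by (metis mult_zero_right zero_neq_one)
  have k_eq: "\<kappa> (Suc n) = 1 / x (Suc n)" for n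
    using kx[of n] x_nz[of n] by (simp add: field_simps)
  have K: "coeff (P (Suc n)) (Suc n) = y n * (2 / r) ^ Suc n / x (Suc n)" for n
    unfolding P_eq k_eq coeff_smult coeff_orthopoly y_def by simp
  define N where "N = (\<lambda>n. form (P n) (P n))"
  have N: "N (Suc n) = 2 * y n * E (2 * n + 2) / (x (Suc n))\<^sup>2" for n
    unfolding N_def P_eq form_smult_right form_commute[of "smult _ _"] form_orthopoly_self y_def k_eq
    by (simp add: power2_eq_square)
  have poly_rec: "P (Suc (Suc n)) = smult (a (n + 2)) (P (Suc n)) + smult (b (n + 2)) (pCons 0 (P (Suc n)))
      + smult (1 - a (n + 2)) (P n)" for n
  proof -
    have "poly (P (Suc (Suc n))) = poly (smult (a (n + 2)) (P (Suc n)) +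
        smult (b (n + 2)) (pCons 0 (P (Suc n))) + smult (1 - a (n + 2)) (P n))"
    proof
      fix u
      have "poly (P (n + 2)) u = (a (n + 2) + b (n + 2) * u) * poly (P (n + 2 - 1)) u
          + (1 - a (n + 2)) * poly (P (n + 2 - 2)) u"
        using rec unfolding three_term_recurrence_def by (metis le_add2)
      then show "poly (P (Suc (Suc n))) u = poly (smult (a (n + 2)) (P (Suc n)) +
        smult (b (n + 2)) (pCons 0 (P (Suc n))) + smult (1 - a (n + 2)) (P n)) u"
        by (simp add: algebra_simps)
    qed
    then show ?thesis by (simp only: poly_eq_poly_eq_iff)
  qed
  have b_eq: "b (n + 2) = coeff (P (Suc (Suc n))) (Suc (Suc n)) / coeff (P (Suc n)) (Suc n)" for n
  proof -
    have "coeff (P (Suc (Suc n))) (Suc (Suc n)) = b (n + 2) * coeff (P (Suc n)) (Suc n)"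
      by (subst poly_rec) (simp add: degree_P coeff_eq_0)
    then show ?thesis using coeff_P[of "Suc n"] by simp
  qed
  have x_lim: "(\<lambda>n. x (Suc n) / x n) \<longlonglongrightarrow> z"
    using orthopoly_ratio_tendsto[OF z(1)] unfolding z(2) x_def .
  have x_lim': "(\<lambda>n. x (Suc n) / x (Suc (Suc n))) \<longlonglongrightarrow> 1 / z"
    using tendsto_divide[OF tendsto_const[of 1] LIMSEQ_Suc[OF x_lim]] z(1) by auto
  have "(\<lambda>n. \<alpha> (2 * n + 1)) \<longlonglongrightarrow> 0"
    by (rule filterlim_compose[OF verblunsky_tendsto_0 filterlim_subseq]) (auto simp: strict_mono_def)
  then have y_lim: "y \<longlonglongrightarrow> 1"
    unfolding y_def by (auto intro!: tendsto_eq_intros)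
  have y_lim': "(\<lambda>n. y (Suc n) / y n) \<longlonglongrightarrow> 1"
    using tendsto_divide[OF LIMSEQ_Suc[OF y_lim] y_lim] by simp
  have E_lim: "(\<lambda>n. E (2 * n + 4) / E (2 * n + 2)) \<longlonglongrightarrow> 1"
  proof -
    have sub: "filterlim (\<lambda>n. 2 * n + k) sequentially sequentially" for k :: nat
      by (rule filterlim_subseq) (auto simp: strict_mono_def)
    have "(\<lambda>n. E (Suc (2 * n + 3)) / E (2 * n + 3) * (E (Suc (2 * n + 2)) / E (2 * n + 2))) \<longlonglongrightarrow> 1 * 1"
      by (intro tendsto_mult filterlim_compose[OF E_ratio_tendsto sub])
    also have "(\<lambda>n. E (Suc (2 * n + 3)) / E (2 * n + 3) * (E (Suc (2 * n + 2)) / E (2 * n + 2))) =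
        (\<lambda>n. E (2 * n + 4) / E (2 * n + 2))"
    proof
      fix n
      have "E (2 * n + 3) \<noteq> 0" using E_pos[of "2 * n + 3"] by simp
      moreover have "Suc (2 * n + 3) = 2 * n + 4" "Suc (2 * n + 2) = 2 * n + 3" by simp_all
      ultimately show "E (Suc (2 * n + 3)) / E (2 * n + 3) * (E (Suc (2 * n + 2)) / E (2 * n + 2)) =
          E (2 * n + 4) / E (2 * n + 2)" by (simp only:) simp
    qed
    finally show ?thesis by simp
  qed
  have b_formula: "b (n + 2) = (y (Suc n) / y n) * (2 / r) * (x (Suc n) / x (Suc (Suc n)))" for n
    unfolding b_eq K using r_pos y_pos[of n] x_nz[of n] by (simp add: field_simps)
  have b_lim: "(\<lambda>n. b (n + 2)) \<longlonglongrightarrow> 2 / (r * z)"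
    unfolding b_formula using tendsto_mult[OF tendsto_mult[OF y_lim' tendsto_const[of "2 / r"]] x_lim'] by simp
  then show "b \<longlonglongrightarrow> 2 / (r * z)" by (rule LIMSEQ_offset)
  have b_nz: "b (n + 2) \<noteq> 0" for n
    unfolding b_eq using coeff_P by simp
  have N_pos: "N n \<noteq> 0" for n
    using form_self_eq_0[of "P n"] coeff_P[of n] by (auto simp: N_def)
  have a_eq: "a (n + 3) - 1 = b (n + 3) / b (n + 2) * (N (Suc (Suc n)) / N (Suc n))" for n
  proof -
    \<comment> \<open>The form of \<open>P (n + 2)\<close> with \<open>x * P (n + 1)\<close> is computed from the recurrence for \<open>P (n + 2)\<close>.\<close>
    let ?X = "form (P (Suc (Suc n))) (pCons 0 (P (Suc n)))"
    have "form (P (Suc (Suc n))) (P (Suc (Suc n))) = b (n + 2) * ?X"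
      by (subst (2) poly_rec) (simp add: form_add_right form_smult_right orth del: smult_pCons)
    then have X: "?X = N (Suc (Suc n)) / b (n + 2)" using b_nz[of n] by (simp add: N_def)
    have "0 = form (P (Suc n)) (P (Suc (Suc (Suc n))))" by (simp add: orth)
    also have "\<dots> = b (n + 3) * form (P (Suc n)) (pCons 0 (P (Suc (Suc n)))) + (1 - a (n + 3)) * N (Suc n)"
      by (subst poly_rec) (simp add: form_add_right form_smult_right orth N_def eval_nat_numeral del: smult_pCons)
    also have "form (P (Suc n)) (pCons 0 (P (Suc (Suc n)))) = ?X" by (rule form_pCons_swap)
    finally show ?thesis unfolding X using N_pos[of "Suc n"] b_nz[of n] by (simp add: field_simps)
  qed
  have N_ratio: "N (Suc (Suc n)) / N (Suc n) =
      (y (Suc n) / y n) * (E (2 * n + 4) / E (2 * n + 2)) * (x (Suc n) / x (Suc (Suc n)))\<^sup>2" for n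
  proof -
    have "2 * Suc n + 2 = 2 * n + 4" by simp
    then show ?thesis
      unfolding N using x_nz[of n] x_nz[of "Suc n"] y_pos[of n] E_pos[of "2 * n + 2"]
      by (simp only:) (simp add: field_simps power_divide)
  qed
  have N_lim: "(\<lambda>n. N (Suc (Suc n)) / N (Suc n)) \<longlonglongrightarrow> 1 / z\<^sup>2"
    unfolding N_ratio using tendsto_mult[OF tendsto_mult[OF y_lim' E_lim] tendsto_power[OF x_lim', of 2]]
    by (simp add: power_divide)
  have "(\<lambda>n. b (Suc n + 2) / b (n + 2) * (N (Suc (Suc n)) / N (Suc n))) \<longlonglongrightarrow> (2 / (r * z)) / (2 / (r * z)) * (1 / z\<^sup>2)"
    using r_pos z(1) by (intro tendsto_mult tendsto_divide N_lim b_lim LIMSEQ_Suc[OF b_lim]) auto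
  moreover have "(2 / (r * z)) / (2 / (r * z)) * (1 / z\<^sup>2) = 1 / z\<^sup>2"
    using r_pos z(1) by auto
  moreover have "a (n + 3) - 1 = b (Suc n + 2) / b (n + 2) * (N (Suc (Suc n)) / N (Suc n))" for n
    using a_eq[of n] by (simp add: eval_nat_numeral)
  ultimately have "(\<lambda>n. a (n + 3) - 1) \<longlonglongrightarrow> 1 / z\<^sup>2"
    by (simp only:)
  then show "(\<lambda>t. a t - 1) \<longlonglongrightarrow> 1 / z\<^sup>2" by (rule LIMSEQ_offset)
qed

end

section \<open>Convergence to Polyak momentum\<close>

theorem theorem3:
  fixes l L :: real
    and M :: "'w measure"
    and H :: "'w \<Rightarrow> real^'n^'n"
    and \<mu> :: "real measure"
    and f :: "real \<Rightarrow> real"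
    and a b :: "nat \<Rightarrow> real"
  assumes "0 < l" and "l < L"
    and "prob_space M"
    and "H \<in> borel_measurable M"
    and "AE \<omega> in M. symmetric_positive_definite (H \<omega>)"
    and "\<mu> = expected_spectral_distribution M H"
    and "f \<in> borel_measurable borel"
    and "\<mu> = density lborel (\<lambda>x. ennreal (f x))"
    and "\<And>x. x \<in> {l..L} \<Longrightarrow> f x > 0"
    and "\<And>x. x \<notin> {l..L} \<Longrightarrow> f x = 0"
    and "optimal_average_case_parameters \<mu> a b"
  shows "(\<lambda>t. a t - 1) \<longlonglongrightarrow> ((sqrt L - sqrt l) / (sqrt L + sqrt l))\<^sup>2 \<and>
         b \<longlonglongrightarrow> - (2 / (sqrt L + sqrt l))\<^sup>2"
proof -
  note [measurable] = assms(7)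
  define A where "A = density \<mu> (\<lambda>x. ennreal x)"
  obtain P where degree_P: "\<And>i. degree (P i) = i"
    and orth: "\<And>i j. i \<noteq> j \<Longrightarrow> (\<integral>x. poly (P i) x * poly (P j) x \<partial>A) = 0"
    and norm: "\<And>i. (\<integral>x. (poly (P i) x)\<^sup>2 \<partial>A) > 0"
    and residual: "\<And>i. poly (P i) 0 = 1"
    and rec: "three_term_recurrence P a b"
    using assms(11)
    unfolding optimal_average_case_parameters_def residual_orthogonal_polynomials_def
      orthogonal_polynomials_def A_def by blast
  define w where "w = (\<lambda>x. x * f x)"
  have [measurable]: "w \<in> borel_measurable borel" unfolding w_def by measurable
  have f_nonneg: "0 \<le> f x" for x using assms(9)[of x] assms(10)[of x] by (cases "x \<in> {l..L}") auto
  have w_nonneg: "0 \<le> w x" for x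
    using assms(1) assms(10)[of x] f_nonneg[of x] by (cases "x \<in> {l..L}") (auto simp: w_def)
  have "A = density lborel (\<lambda>x. ennreal (f x) * ennreal x)"
    unfolding A_def assms(8) by (rule density_density_eq) measurable
  also have "(\<lambda>x. ennreal (f x) * ennreal x) = (\<lambda>x. ennreal (w x))"
  proof
    fix x
    show "ennreal (f x) * ennreal x = ennreal (w x)"
    proof (cases "x \<in> {l..L}")
      case True
      then show ?thesis using assms(1) f_nonneg[of x]
        by (simp add: w_def ennreal_mult mult.commute)
    qed (simp add: w_def assms(10))
  qed
  finally have A: "A = density lborel (\<lambda>x. ennreal (w x))" .
  have integral_A: "(\<integral>x. F x \<partial>A) = (\<integral>x. F x * w x \<partial>lborel)"
    if "F \<in> borel_measurable borel" for F :: "real \<Rightarrow> real"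
    unfolding A using that w_nonneg by (subst integral_density) (auto simp: mult.commute)
  have "poly (P 0) x = 1" for x using rec by (simp add: three_term_recurrence_def)
  \<comment> \<open>A positive Bochner integral is the integral of an integrable function.\<close>
  then have "(\<integral>x. w x \<partial>lborel) > 0" using norm[of 0] integral_A[of "\<lambda>_. 1"] by simp
  then have "integrable lborel w" using not_integrable_integral_eq by fastforce
  then interpret interval_weight l L w
    using assms by unfold_locales (auto simp: w_def)
  have form: "form p q = (\<integral>x. poly p x * poly q x \<partial>A)" for p q
    unfolding form_def
    by (rule integral_A[symmetric]) (intro borel_measurable_times borel_measurable_continuous_onI continuous_intros)
  define u where "u = sqrt L"
  define v where "v = sqrt l"
  have uv: "0 < v" "v < u" and L: "L = u\<^sup>2" and l: "l = v\<^sup>2"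
    using assms(1,2) by (simp_all add: u_def v_def)
  \<comment> \<open>The solution outside the disc of \<open>c + r (z + 1/z) / 2 = 0\<close>.\<close>
  define z where "z = - ((u + v) / (u - v))"
  have z: "\<bar>z\<bar> > 1" using uv by (simp add: z_def field_simps)
  have r_eq: "r = (u - v) * (u + v) / 2"
    unfolding r_def unfolding L l by (simp add: power2_eq_square algebra_simps)
  have c_eq: "c = ((u + v)\<^sup>2 + (u - v)\<^sup>2) / 4"
    unfolding c_def unfolding L l by (simp add: power2_eq_square algebra_simps)
  have "(q\<^sup>2 + p\<^sup>2) / 4 + p * q / 2 * (- (q / p) + 1 / - (q / p)) / 2 = 0" if "p \<noteq> 0" "q \<noteq> 0" for p q :: real
    using that by (simp add: field_simps power2_eq_square)
  from this[of "u - v" "u + v"] have "c + r * (z + 1 / z) / 2 = 0"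
    unfolding c_eq r_eq z_def using uv by auto
  note limits = recurrence_coefficients_tendsto[OF z this degree_P _ residual rec]
  have "1 / z\<^sup>2 = ((u - v) / (u + v))\<^sup>2"
    by (simp add: z_def power_divide)
  moreover have "2 / (r * z) = - (2 / (u + v))\<^sup>2"
  proof -
    have "2 / (p * q / 2 * - (q / p)) = - (2 / q)\<^sup>2" if "p \<noteq> 0" "q \<noteq> 0" for p q :: real
      using that by (simp add: field_simps power2_eq_square)
    from this[of "u - v" "u + v"] show ?thesis unfolding r_eq z_def using uv by auto
  qed
  ultimately show ?thesis
    using limits by (simp add: form orth u_def v_def)
qed

end
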